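(* Suppose $\lambda^{(1)},\lambda^{(2)},\ldots$ is a sequence of partitions, and for each $N$ let $\mathcal{X}_N=\mathcal{X}_{\lambda^{(N)}}[\mathrm{maj}]$ be the random variable given by the major index statistic $\mathrm{maj}$ on $\mathrm{SYT}(\lambda^{(N)})$ under the uniform distribution. Then the sequence $\mathcal{X}_1,\mathcal{X}_2,\ldots$ is asymptotically normal if and only if $\mathrm{aft}(\lambda^{(N)})\to\infty$ as $N\to\infty$.
   Context: $\mathrm{SYT}(\lambda)$ is the set of standard Young tableaux of shape $\lambda\vdash n$ (English notation): bijective fillings of the diagram with $1,\dots,n$ increasing along rows and down columns. An integer $i$ is a descent of $T$ if $i+1$ appears in a strictly lower row of $T$ than $i$; $\mathrm{maj}(T)$ is the sum of the descents of $T$. The aft of a partition $\lambda$ is $\mathrm{aft}(\lambda):=|\lambda|-\max\{\lambda_1,\lambda_1'\}$, where $\lambda'$ is the conjugate partition. For a real-valued random variable $\mathcal{X}$ with mean $\mu$ and standard deviation $\sigma$, $\mathcal{X}^*:=(\mathcal{X}-\mu)/\sigma$; if $\sigma=0$, set $\mathcal{X}^*:=0$. A sequence $\mathcal{X}_1,\mathcal{X}_2,\dots$ is asymptotically normal if for all $t\in\mathbb{R}$, $\lim_{N\to\infty}\mathbb{P}[\mathcal{X}_N^*\le t]=\mathbb{P}[\mathcal{N}\le t]$, where $\mathcal{N}$ is a standard normal random variable. *)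

theory Defs
  imports "HOL-Probability.Probability" "HOL-Library.FuncSet"
begin

section \<open>Partitions\<close>

text \<open>A partition is the list of its nonzero parts in weakly decreasing order; the empty list is the
  partition of \<open>0\<close>.\<close>

definition is_partition :: "nat list \<Rightarrow> bool" where
  "is_partition lam \<longleftrightarrow> sorted_wrt (\<ge>) lam \<and> (\<forall>p\<in>set lam. 0 < p)"

definition first_part :: "nat list \<Rightarrow> nat" where
  "first_part lam = (case lam of [] \<Rightarrow> 0 | p # _ \<Rightarrow> p)"

definition conjugate :: "nat list \<Rightarrow> nat list" where
  "conjugate lam = map (\<lambda>j. card {i. i < length lam \<and> j < lam ! i}) [0..<first_part lam]"

text \<open>The truncated subtraction is exact: for a partition, neither the first part nor the number of
  parts exceeds the size.\<close>

definition aft :: "nat list \<Rightarrow> nat" where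
  "aft lam = sum_list lam - max (first_part lam) (first_part (conjugate lam))"


section \<open>Standard Young tableaux and the major index\<close>

text \<open>Cells are pairs (row, column), both counted from \<open>0\<close>, with rows numbered from top to bottom.\<close>

definition diagram :: "nat list \<Rightarrow> (nat \<times> nat) set" where
  "diagram lam = {(i, j). i < length lam \<and> j < lam ! i}"

text \<open>Tableaux are extensional functions, so that each filling of the diagram is counted once.\<close>

definition SYT :: "nat list \<Rightarrow> (nat \<times> nat \<Rightarrow> nat) set" where
  "SYT lam = {T \<in> extensional (diagram lam).
     bij_betw T (diagram lam) {1..sum_list lam} \<and>
     (\<forall>i j k. (i, j) \<in> diagram lam \<and> (i, k) \<in> diagram lam \<and> j < k \<longrightarrow> T (i, j) < T (i, k)) \<and>
     (\<forall>i k j. (i, j) \<in> diagram lam \<and> (k, j) \<in> diagram lam \<and> i < k \<longrightarrow> T (i, j) < T (k, j))}"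

definition descents :: "nat list \<Rightarrow> (nat \<times> nat \<Rightarrow> nat) \<Rightarrow> nat set" where
  "descents lam T = {d. \<exists>c\<in>diagram lam. \<exists>c'\<in>diagram lam. T c = d \<and> T c' = d + 1 \<and> fst c < fst c'}"

definition maj :: "nat list \<Rightarrow> (nat \<times> nat \<Rightarrow> nat) \<Rightarrow> nat" where
  "maj lam T = \<Sum>(descents lam T)"


section \<open>Asymptotic normality\<close>

definition standardize :: "'a measure \<Rightarrow> ('a \<Rightarrow> real) \<Rightarrow> 'a \<Rightarrow> real" where
  "standardize M X = (let \<mu> = prob_space.expectation M X; \<sigma> = sqrt (prob_space.variance M X)
     in (\<lambda>\<omega>. if \<sigma> = 0 then 0 else (X \<omega> - \<mu>) / \<sigma>))"

text \<open>The random variables of the sequence may live on different probability spaces.\<close>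

definition asymptotically_normal :: "(nat \<Rightarrow> 'a measure) \<Rightarrow> (nat \<Rightarrow> 'a \<Rightarrow> real) \<Rightarrow> bool" where
  "asymptotically_normal M X \<longleftrightarrow>
     (\<forall>t. (\<lambda>N. measure (M N) {\<omega> \<in> space (M N). standardize (M N) (X N) \<omega> \<le> t})
            \<longlonglongrightarrow> measure std_normal_distribution {..t})"


section \<open>The uniform distribution on tableaux is well defined\<close>

text \<open>\<^const>\<open>pmf_of_set\<close> is the uniform distribution only on finite nonempty sets.\<close>

lemma finite_diagram: "finite (diagram lam)"
proof -
  have "diagram lam = (SIGMA i:{..<length lam}. {..<lam ! i})"
    by (auto simp: diagram_def)
  then show ?thesis by simp
qed

lemma finite_SYT: "finite (SYT lam)"
proof (rule finite_subset)
  show "SYT lam \<subseteq> diagram lam \<rightarrow>\<^sub>E {1..sum_list lam}"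
    by (auto simp: SYT_def PiE_def bij_betw_def)
  show "finite (diagram lam \<rightarrow>\<^sub>E {1..sum_list lam})"
    by (intro finite_PiE finite_diagram) auto
qed

lemma card_diagram: "card (diagram lam) = sum_list lam"
proof -
  have "diagram lam = (SIGMA i:{..<length lam}. {..<lam ! i})"
    by (auto simp: diagram_def)
  then have "card (diagram lam) = (\<Sum>i<length lam. lam ! i)"
    by simp
  then show ?thesis by (simp add: sum_list_sum_nth atLeast0LessThan)
qed

text \<open>The row-by-row filling is a standard tableau.\<close>

lemma SYT_nonempty: "SYT lam \<noteq> {}"
proof -
  define s where "s i = sum_list (take i lam)" for i
  define T where "T = restrict (\<lambda>(i, j). s i + j + 1) (diagram lam)"
  have s_Suc: "s (Suc i) = s i + lam ! i" if "i < length lam" for i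
    using that by (simp add: s_def take_Suc_conv_app_nth)
  have s_mono: "s i \<le> s k" if "i \<le> k" for i k
  proof -
    have "take k lam = take i lam @ take (k - i) (drop i lam)"
      using that by (metis le_add_diff_inverse take_add)
    then show ?thesis by (simp add: s_def)
  qed
  have rows: "s i + j < s k" if "(i, j) \<in> diagram lam" "i < k" for i j k
    using s_Suc[of i] s_mono[of "Suc i" k] that by (auto simp: diagram_def)
  have inj: "inj_on T (diagram lam)"
  proof (rule inj_onI, clarify)
    fix i j k l
    assume c: "(i, j) \<in> diagram lam" "(k, l) \<in> diagram lam" "T (i, j) = T (k, l)"
    then have eq: "s i + j = s k + l" by (simp add: T_def)
    then have "i = k"
      using rows[OF c(1), of k] rows[OF c(2), of i] by (cases i k rule: linorder_cases) auto
    with eq show "i = k \<and> j = l" by simp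
  qed
  have "T ` diagram lam \<subseteq> {1..sum_list lam}"
  proof clarify
    fix i j assume c: "(i, j) \<in> diagram lam"
    then have "s i + j < s (length lam)" by (intro rows) (auto simp: diagram_def)
    with c show "T (i, j) \<in> {1..sum_list lam}" by (simp add: T_def s_def)
  qed
  then have "T ` diagram lam = {1..sum_list lam}"
    by (intro card_subset_eq) (auto simp: card_image[OF inj] card_diagram)
  with inj have bij: "bij_betw T (diagram lam) {1..sum_list lam}"
    by (simp add: bij_betw_def)
  have "T \<in> SYT lam"
    unfolding SYT_def using bij rows by (fastforce simp: T_def)
  then show ?thesis by blast
qed

end

theory Submission
  imports Defs "Jordan_Normal_Form.Determinant" "HOL-Real_Asymp.Real_Asymp"
begin

text \<open>Let \<open>a = aft lam\<close> and \<open>n = \<bar>lam\<bar>\<close>. Deleting the largest entry of a tableau gives a recursion that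
  proves the \<open>q\<close>-hook length formula for \<^const>\<open>maj\<close>; after the hooks of the longest row or column
  are cancelled, the characteristic function of the centered major index is
  \<open>\<Prod>j\<in>J. sinc (j t / 2)\<close> over \<open>\<Prod>h\<in>K. sinc (h t / 2)\<close> with \<open>a\<close> factors above and below and all
  \<open>j, h \<le> n\<close>. Its logarithm differs from \<open>- V t\<^sup>2 / 2\<close> by at most a multiple of \<open>a (n t) ^ 4\<close>, where
  \<open>V\<close> is the variance. Since \<open>\<Sum> h\<^sup>2 = n\<^sup>2 + \<Sum> c\<^sup>2\<close> for hook lengths \<open>h\<close> and contents \<open>c\<close>, one gets
  \<open>V \<ge> a n\<^sup>2 / 648\<close>. So for \<open>t = s / sqrt V\<close> the error is \<open>O(s ^ 4 / a)\<close>, and Levy's continuity theorem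
  applies if \<open>a\<close> tends to infinity. Conversely, the major index deviates downwards from its mean by at
  most \<open>a n / 2\<close>, so a bounded \<open>a\<close> keeps the standardized variables bounded from below, unlike
  a normal variable.\<close>

section \<open>A determinant over shifted parts\<close>

text \<open>Whether a new largest entry creates a descent depends on the row of the previous one, so
  the recursion has to remember that row. In the determinant this memory is the number of
  differenced rows. The recursion closes because differencing all rows merely multiplies the
  determinant quotient by \<open>q ^ n\<close>.

  The cancellation is what makes a slowly growing \<open>a\<close> tractable. The variance bound
  yields only \<open>(n t)^2 = O(s^2 / a)\<close>; summed over all \<open>n\<close> factors, the
  same estimate of the logarithm would give an error of order \<open>n s^4 / a^2\<close>, which is
  useless if \<open>a\<close> does not outgrow the square root of \<open>n\<close>.

  The number of tableaux, the mean and the variance are not computed beforehand: all three are read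
  off from the product formula as \<open>t\<close> tends to 0 from the right.\<close>

abbreviation vandermonde :: "nat \<Rightarrow> (nat \<Rightarrow> 'a::comm_ring_1) \<Rightarrow> 'a" where
  "vandermonde m x \<equiv> Determinant.det (mat m m (\<lambda>(i, j). x i ^ j))"

text \<open>Expanding the polynomials in powers factors the matrix into the power matrix and the
  matrix of coefficients, which the degree bound makes upper triangular.\<close>

lemma det_poly_columns:
  fixes x :: "nat \<Rightarrow> 'a::idom"
  assumes deg: "\<And>j. j < m \<Longrightarrow> degree (p j) \<le> j"
  shows "Determinant.det (mat m m (\<lambda>(i, j). poly (p j) (x i)))
       = (\<Prod>j<m. coeff (p j) j) * vandermonde m x"
proof -
  define U where "U = mat m m (\<lambda>(k, j). coeff (p j) k)"
  define W where "W = mat m m (\<lambda>(i, j). x i ^ j)"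
  have U: "U \<in> carrier_mat m m" and W: "W \<in> carrier_mat m m"
    by (auto simp: U_def W_def)
  have "mat m m (\<lambda>(i, j). poly (p j) (x i)) = W * U"
  proof (rule eq_matI)
    fix i j assume "i < dim_row (W * U)" "j < dim_col (W * U)"
    then have ij: "i < m" "j < m" using U W by auto
    have "poly (p j) (x i) = (\<Sum>k\<le>j. coeff (p j) k * x i ^ k)"
      unfolding poly_altdef
      by (rule sum.mono_neutral_left) (use deg[OF ij(2)] in \<open>auto simp: coeff_eq_0\<close>)
    also have "\<dots> = (\<Sum>k<m. x i ^ k * coeff (p j) k)"
      by (rule sum.mono_neutral_cong_left)
        (use deg[OF ij(2)] ij in \<open>auto simp: coeff_eq_0 mult.commute\<close>)
    finally show "mat m m (\<lambda>(i, j). poly (p j) (x i)) $$ (i, j) = (W * U) $$ (i, j)"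
      using ij by (auto simp: U_def W_def scalar_prod_def atLeast0LessThan)
  qed (use U W in auto)
  then have "Determinant.det (mat m m (\<lambda>(i, j). poly (p j) (x i)))
      = Determinant.det W * Determinant.det U"
    using det_mult[OF W U] by simp
  also have "Determinant.det U = prod_list (diag_mat U)"
  proof (rule det_upper_triangular[OF _ U])
    have "coeff (p j) k = 0" if "k < m" "j < k" for j k
      using deg[of j] that by (intro coeff_eq_0) auto
    then show "upper_triangular U"
      by (auto simp: U_def)
  qed
  also have "\<dots> = (\<Prod>j<m. coeff (p j) j)"
    by (auto simp: diag_mat_def U_def prod.list_conv_set_nth atLeast0LessThan)
  finally show ?thesis by (simp add: W_def)
qed

lemma vandermonde_eq_prod:
  fixes x :: "nat \<Rightarrow> 'a::idom"
  shows "vandermonde m x = (\<Prod>j<m. \<Prod>k<j. x j - x k)"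
proof -
  \<comment> \<open>Newton basis: \<open>p j\<close> vanishes at all nodes before \<open>j\<close>,
    so its matrix of values is lower triangular.\<close>
  define p where "p j = (\<Prod>k<j. [:- x k, 1:])" for j
  have monic: "degree (p j) = j \<and> coeff (p j) j = 1" for j
  proof -
    have "degree (p j) = (\<Sum>k<j. degree [:- x k, 1:])"
      unfolding p_def by (rule degree_prod_eq_sum_degree) auto
    moreover have "lead_coeff (p j) = 1"
      unfolding p_def lead_coeff_prod by (rule prod.neutral) auto
    ultimately show ?thesis by simp
  qed
  define A where "A = mat m m (\<lambda>(i, j). poly (p j) (x i))"
  have A: "A \<in> carrier_mat m m" by (simp add: A_def)
  have "vandermonde m x = Determinant.det A"
    using det_poly_columns[of m p x] monic by (simp add: A_def)
  also have "\<dots> = prod_list (diag_mat A)"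
    by (rule det_lower_triangular[OF _ A]) (auto simp: A_def p_def poly_prod)
  also have "\<dots> = (\<Prod>j<m. poly (p j) (x j))"
    by (auto simp: diag_mat_def A_def prod.list_conv_set_nth atLeast0LessThan)
  finally show ?thesis by (simp add: p_def poly_prod)
qed

section \<open>Difference operators on a Vandermonde determinant over q-factorials\<close>

definition qfac :: "'a::comm_ring_1 \<Rightarrow> nat \<Rightarrow> 'a" where
  "qfac q n = (\<Prod>j=1..n. 1 - q ^ j)"

lemma qfac_0 [simp]: "qfac q 0 = 1"
  by (simp add: qfac_def)

lemma qfac_Suc: "qfac q (Suc n) = (1 - q ^ Suc n) * qfac q n"
  by (simp add: qfac_def mult.commute)

text \<open>Let \<open>F l\<close> be the determinant with entries \<open>(q * q ^ l i) ^ j\<close> divided by \<open>\<Prod>i<m. qfac q (l i)\<close>, and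
  let \<open>\<tau> i\<close> be the operator that lowers the argument \<open>l i\<close> of \<open>F\<close> by one. Then \<open>shift_det m q l r\<close> is
  \<open>(\<Prod>i<r. 1 - \<tau> i) F l\<close>: the rows \<open>i < r\<close> hold the differences of the rows for \<open>l i\<close> and \<open>l i - 1\<close>.\<close>

definition shift_entry :: "'a::field \<Rightarrow> (nat \<Rightarrow> nat) \<Rightarrow> nat \<Rightarrow> nat \<Rightarrow> nat \<Rightarrow> 'a" where
  "shift_entry q l r i j = (let x = q ^ l i in
     if i < r then x ^ Suc j + (q ^ j - 1) * x ^ j else (q * x) ^ j)"

definition shift_det :: "nat \<Rightarrow> 'a::field \<Rightarrow> (nat \<Rightarrow> nat) \<Rightarrow> nat \<Rightarrow> 'a" where
  "shift_det m q l r = Determinant.det (mat m m (\<lambda>(i, j). shift_entry q l r i j)) / (\<Prod>i<m. qfac q (l i))"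

lemma shift_det_0: "shift_det m q l 0 = q ^ (\<Sum>i<m. i) * vandermonde m (\<lambda>i. q ^ l i) / (\<Prod>i<m. qfac q (l i))"
proof -
  have "Determinant.det (mat m m (\<lambda>(i, j). shift_entry q l 0 i j))
      = Determinant.det (mat m m (\<lambda>(i, j). poly (monom (q ^ j) j) (q ^ l i)))"
    by (intro arg_cong[where f = Determinant.det] eq_matI)
      (auto simp: shift_entry_def poly_monom power_mult_distrib)
  also have "\<dots> = (\<Prod>j<m. q ^ j) * vandermonde m (\<lambda>i. q ^ l i)"
    by (subst det_poly_columns) (auto simp: degree_monom_le)
  finally show ?thesis by (simp add: shift_det_def power_sum)
qed

text \<open>A differenced row is \<open>q ^ l i\<close> times the values of monic polynomials
  \<open>p j\<close> of degree \<open>j\<close>, so the Vandermonde determinant reappears. Compared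
  with \<open>shift_det_0\<close> only the power of \<open>q\<close> changes: \<open>F\<close> is an
  eigenfunction of the product of all \<open>1 - \<tau> i\<close>.\<close>

lemma shift_det_top: "shift_det m q l m = q ^ (\<Sum>i<m. l i) * vandermonde m (\<lambda>i. q ^ l i) / (\<Prod>i<m. qfac q (l i))"
proof -
  define p where "p j = monom 1 j + Polynomial.smult (q ^ j - 1) (monom 1 (j - 1))" for j
  define A where "A = mat m m (\<lambda>(i, j). poly (p j) (q ^ l i))"
  have A: "A \<in> carrier_mat m m" by (simp add: A_def)
  have "mat m m (\<lambda>(i, j). shift_entry q l m i j) = mat\<^sub>r m m (\<lambda>i. q ^ l i \<cdot>\<^sub>v row A i)"
  proof (rule eq_matI)
    have "x ^ Suc j + (q ^ j - 1) * x ^ j = x * poly (p j) x" for x j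
      unfolding p_def by (cases j) (simp_all add: poly_monom distrib_left mult.left_commute)
    then show "mat m m (\<lambda>(i, j). shift_entry q l m i j) $$ (i, j) = mat\<^sub>r m m (\<lambda>i. q ^ l i \<cdot>\<^sub>v row A i) $$ (i, j)"
      if "i < dim_row (mat\<^sub>r m m (\<lambda>i. q ^ l i \<cdot>\<^sub>v row A i))" "j < dim_col (mat\<^sub>r m m (\<lambda>i. q ^ l i \<cdot>\<^sub>v row A i))" for i j
      using that by (simp add: shift_entry_def Let_def A_def)
  qed auto
  then have "Determinant.det (mat m m (\<lambda>(i, j). shift_entry q l m i j))
      = (\<Prod>i<m. q ^ l i) * Determinant.det (mat\<^sub>r m m (\<lambda>i. row A i))"
    using det_rows_mul[of "row A" m "\<lambda>i. q ^ l i"] A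
    by (auto simp: atLeast0LessThan)
  also have "mat\<^sub>r m m (\<lambda>i. row A i) = A"
    using A by (intro eq_matI) auto
  also have "Determinant.det A = vandermonde m (\<lambda>i. q ^ l i)"
  proof -
    have "degree (p j) \<le> j" for j
      by (rule degree_le) (auto simp: p_def)
    moreover have "coeff (p j) j = 1" for j
      by (cases j) (auto simp: p_def)
    ultimately show ?thesis
      unfolding A_def by (subst det_poly_columns) auto
  qed
  finally show ?thesis by (simp add: shift_det_def power_sum)
qed

text \<open>By linearity in row \<open>r\<close>, the difference is the determinant with row
  \<open>r\<close> replaced by powers of \<open>q ^ l r\<close>, times \<open>1 - q ^ l r\<close>.
  These powers are the undifferenced row for \<open>l r - 1\<close>, and the factor shortens
  \<open>qfac q (l r)\<close> accordingly. It vanishes for \<open>l r = 0\<close>, whence the value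
  0.\<close>

lemma shift_det_step:
  fixes q :: "'a::field"
  assumes r: "r < m" and q: "l r > 0 \<Longrightarrow> q ^ l r \<noteq> 1"
  shows "shift_det m q l r - shift_det m q l (Suc r) = (if l r = 0 then 0 else shift_det m q (l(r := l r - 1)) r)"
proof -
  define l' where "l' = l(r := l r - 1)"
  define y where "y = 1 - q ^ l r"
  define c where "c i = vec m (shift_entry q l r i)" for i
  define w where "w = vec m (\<lambda>j. (q ^ l r) ^ j)"
  define u where "u = vec m (shift_entry q l (Suc r) r)"
  define R where "R v = mat\<^sub>r m m (\<lambda>i. if i = r then v else c i)" for v
  have carr: "w \<in> carrier_vec m" "u \<in> carrier_vec m" "\<And>i. c i \<in> carrier_vec m"
    by (auto simp: w_def u_def c_def)
  have entry: "shift_entry q l r r j = shift_entry q l (Suc r) r j + y * (q ^ l r) ^ j" for j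
    unfolding shift_entry_def Let_def y_def by (simp add: power_mult_distrib) (simp add: algebra_simps)
  have c_r: "c r = u + y \<cdot>\<^sub>v w"
    by (intro eq_vecI) (simp_all add: c_def u_def w_def entry)
  have "Determinant.det (R (u + y \<cdot>\<^sub>v w)) = Determinant.det (R u) + Determinant.det (R (y \<cdot>\<^sub>v w))"
    unfolding R_def
    by (rule det_row_add[of "\<lambda>_. u" r m "\<lambda>_. y \<cdot>\<^sub>v w" c]) (use carr r in auto)
  moreover have "Determinant.det (R (y \<cdot>\<^sub>v w)) = y * Determinant.det (R w)"
  proof -
    have "R (y \<cdot>\<^sub>v w) = multrow r y (R w)"
      using carr by (intro eq_matI) (auto simp: R_def)
    moreover have "R w \<in> carrier_mat m m" by (simp add: R_def)
    ultimately show ?thesis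
      using det_multrow[of r m "R w" y] r by simp
  qed
  moreover have "R (c r) = mat m m (\<lambda>(i, j). shift_entry q l r i j)"
    by (intro eq_matI) (auto simp: R_def c_def)
  moreover have "R u = mat m m (\<lambda>(i, j). shift_entry q l (Suc r) i j)"
    by (intro eq_matI) (auto simp: R_def c_def u_def shift_entry_def less_Suc_eq)
  ultimately have "Determinant.det (mat m m (\<lambda>(i, j). shift_entry q l r i j))
      = Determinant.det (mat m m (\<lambda>(i, j). shift_entry q l (Suc r) i j)) + y * Determinant.det (R w)"
    using c_r by metis
  then have diff: "shift_det m q l r - shift_det m q l (Suc r)
      = y * Determinant.det (R w) / (\<Prod>i<m. qfac q (l i))"
    unfolding shift_det_def by (simp add: add_divide_distrib)
  show ?thesis
  proof (cases "l r")
    case 0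
    then show ?thesis using diff by (simp add: y_def)
  next
    case (Suc s)
    have y: "y \<noteq> 0" using q Suc by (simp add: y_def)
    have Rw: "R w = mat m m (\<lambda>(i, j). shift_entry q l' r i j)"
      by (intro eq_matI) (auto simp: R_def c_def w_def l'_def shift_entry_def Suc)
    have "(\<Prod>i<m. qfac q (l i)) = qfac q (l r) * (\<Prod>i\<in>{..<m} - {r}. qfac q (l i))"
      using r by (intro prod.remove) auto
    also have "\<dots> = y * (qfac q (l' r) * (\<Prod>i\<in>{..<m} - {r}. qfac q (l' i)))"
    proof -
      have "qfac q (l r) = y * qfac q (l' r)"
        unfolding y_def by (simp only: Suc qfac_Suc l'_def fun_upd_same diff_Suc_1)
      moreover have "(\<Prod>i\<in>{..<m} - {r}. qfac q (l i)) = (\<Prod>i\<in>{..<m} - {r}. qfac q (l' i))"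
        by (rule prod.cong) (auto simp: l'_def)
      ultimately show ?thesis by (simp only: mult.assoc)
    qed
    also have "qfac q (l' r) * (\<Prod>i\<in>{..<m} - {r}. qfac q (l' i)) = (\<Prod>i<m. qfac q (l' i))"
      using r by (intro prod.remove[symmetric]) auto
    finally have "shift_det m q l r - shift_det m q l (Suc r) = Determinant.det (R w) / (\<Prod>i<m. qfac q (l' i))"
      unfolding diff using y by simp
    also have "\<dots> = shift_det m q l' r"
      by (simp only: shift_det_def Rw)
    finally show ?thesis
      by (simp only: Suc l'_def nat.distinct if_False)
  qed
qed

text \<open>Rows from \<open>r\<close> on are undifferenced, so equal arguments give equal rows.
  This kills the removals that would not leave a partition.\<close>

lemma shift_det_identical:
  assumes "r \<le> i" "i < k" "k < m" "l i = l k"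
  shows "shift_det m q l r = 0"
proof -
  have "Determinant.det (mat m m (\<lambda>(i, j). shift_entry q l r i j)) = 0"
    by (rule det_identical_rows[of _ m i k])
      (use assms in \<open>auto simp: shift_entry_def intro!: eq_vecI\<close>)
  then show ?thesis by (simp add: shift_det_def)
qed

section \<open>Removing the largest entry of a tableau\<close>

definition corner :: "nat list \<Rightarrow> nat \<Rightarrow> bool" where
  "corner lam r \<longleftrightarrow> r < length lam \<and> 0 < lam ! r \<and> (Suc r < length lam \<longrightarrow> lam ! Suc r < lam ! r)"

text \<open>An emptied row stays in the list as a zero part. Thus the size of the determinant is
  constant along the recursion, and the lemmas on it assume sortedness instead of
  \<open>is_partition\<close>.\<close>

definition remove_box :: "nat list \<Rightarrow> nat \<Rightarrow> nat list" where
  "remove_box lam r = lam[r := lam ! r - 1]"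

text \<open>For size 0 the row of the entry 0 is arbitrary; the recursions use it there only with
  the factor \<open>1 - q ^ 0\<close> or in a choice between 0 and 0.\<close>

definition row_of :: "nat list \<Rightarrow> (nat \<times> nat \<Rightarrow> nat) \<Rightarrow> nat \<Rightarrow> nat" where
  "row_of lam T d = fst (inv_into (diagram lam) T d)"

lemma SYT_bij: "T \<in> SYT lam \<Longrightarrow> bij_betw T (diagram lam) {1..sum_list lam}"
  by (simp add: SYT_def)

lemma row_of_eqI:
  assumes "T \<in> SYT lam" "c \<in> diagram lam" "T c = d"
  shows "row_of lam T d = fst c"
  using assms SYT_bij[of T lam] inv_into_f_f[of T "diagram lam" c]
  by (auto simp: row_of_def bij_betw_def)

lemma row_of_cell:
  assumes "T \<in> SYT lam" "d \<in> {1..sum_list lam}"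
  obtains j where "(row_of lam T d, j) \<in> diagram lam" "T (row_of lam T d, j) = d"
proof -
  have "d \<in> T ` diagram lam" using assms SYT_bij[of T lam] by (simp add: bij_betw_def)
  then have "inv_into (diagram lam) T d \<in> diagram lam" "T (inv_into (diagram lam) T d) = d"
    by (auto intro: inv_into_into f_inv_into_f)
  then show ?thesis
    using that[of "snd (inv_into (diagram lam) T d)"] by (simp add: row_of_def)
qed

lemma row_of_less:
  assumes "T \<in> SYT lam" "0 < sum_list lam"
  shows "row_of lam T (sum_list lam) < length lam"
  using assms by (auto elim!: row_of_cell[of T lam "sum_list lam"] simp: diagram_def Suc_le_eq)

lemma SYT_rows: "T \<in> SYT lam \<Longrightarrow> (i, j) \<in> diagram lam \<Longrightarrow> (i, k) \<in> diagram lam \<Longrightarrow> j < k \<Longrightarrow> T (i, j) < T (i, k)"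
  by (auto simp: SYT_def)

lemma SYT_cols: "T \<in> SYT lam \<Longrightarrow> (i, j) \<in> diagram lam \<Longrightarrow> (k, j) \<in> diagram lam \<Longrightarrow> i < k \<Longrightarrow> T (i, j) < T (k, j)"
  by (auto simp: SYT_def)

lemma SYT_range: "T \<in> SYT lam \<Longrightarrow> c \<in> diagram lam \<Longrightarrow> T c \<in> {1..sum_list lam}"
  using SYT_bij[of T lam] by (auto simp: bij_betw_def)

lemma largest_entry:
  assumes T: "T \<in> SYT lam" and n: "0 < sum_list lam" and r: "row_of lam T (sum_list lam) = r"
  shows "corner lam r" "T (r, lam ! r - 1) = sum_list lam"
proof -
  let ?n = "sum_list lam"
  obtain j where j: "(r, j) \<in> diagram lam" "T (r, j) = ?n"
    using row_of_cell[of T lam ?n] T n r by (auto simp: Suc_le_eq)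
  have "j = lam ! r - 1"
  proof (rule ccontr)
    assume "j \<noteq> lam ! r - 1"
    then have "(r, Suc j) \<in> diagram lam" using j(1) by (auto simp: diagram_def)
    then show False
      using SYT_rows[OF T j(1)] SYT_range[OF T] j(2) by fastforce
  qed
  then show eq: "T (r, lam ! r - 1) = ?n" using j by simp
  have "lam ! Suc r < lam ! r" if "Suc r < length lam"
  proof (rule ccontr)
    assume "\<not> lam ! Suc r < lam ! r"
    then have "(Suc r, j) \<in> diagram lam" using j(1) that by (auto simp: diagram_def)
    then show False
      using SYT_cols[OF T j(1)] SYT_range[OF T] j(2) by fastforce
  qed
  then show "corner lam r"
    using j(1) by (auto simp: corner_def diagram_def)
qed

section \<open>Deleting a corner: effect on tableaux and on the major index\<close>

context
  fixes lam nu :: "nat list" and r :: nat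
  assumes sorted: "sorted_wrt (\<ge>) lam" and corner: "corner lam r"
  defines "nu \<equiv> remove_box lam r"
begin

lemma diagram_remove_box:
  "diagram lam = insert (r, lam ! r - 1) (diagram nu)" "(r, lam ! r - 1) \<notin> diagram nu"
  using corner
  by (auto simp: diagram_def nu_def remove_box_def corner_def nth_list_update split: if_splits)

lemma sum_list_remove_box: "sum_list lam = Suc (sum_list nu)"
  using card_diagram[of lam] card_diagram[of nu] finite_diagram[of nu] diagram_remove_box
  by simp

lemma restrict_SYT:
  assumes T: "T \<in> SYT lam" and top: "T (r, lam ! r - 1) = sum_list lam"
  shows "restrict T (diagram nu) \<in> SYT nu"
proof -
  let ?c = "(r, lam ! r - 1)"
  have "bij_betw T (diagram lam - {?c}) ({1..sum_list lam} - {T ?c})"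
    using SYT_bij[OF T] SYT_range[OF T, of ?c] diagram_remove_box(1) by (intro bij_betw_DiffI) auto
  moreover have "diagram lam - {?c} = diagram nu" using diagram_remove_box by auto
  moreover have "{1..sum_list lam} - {T ?c} = {1..sum_list nu}"
    using top sum_list_remove_box by auto
  ultimately have "bij_betw T (diagram nu) {1..sum_list nu}" by simp
  then have "bij_betw (restrict T (diagram nu)) (diagram nu) {1..sum_list nu}"
    by (subst bij_betw_cong[where g = T]) auto
  then show ?thesis
    using T diagram_remove_box(1) by (auto simp: SYT_def)
qed

lemma extend_SYT:
  assumes T: "T \<in> SYT nu"
  shows "T((r, lam ! r - 1) := sum_list lam) \<in> SYT lam"
proof -
  let ?c = "(r, lam ! r - 1)" let ?n = "sum_list lam"
  let ?U = "T(?c := ?n)"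
  have U: "?U c = T c" if "c \<in> diagram nu" for c
    using that diagram_remove_box(2) by auto
  have lt: "T c < ?n" if "c \<in> diagram nu" for c
    using SYT_range[OF T that] sum_list_remove_box by auto
  have "bij_betw ?U (diagram nu) {1..sum_list nu}"
    using SYT_bij[OF T] U by (subst bij_betw_cong[where g = T]) auto
  moreover have "bij_betw ?U {?c} {?n}" by (simp add: bij_betw_def)
  moreover have "{1..sum_list nu} \<inter> {?n} = {}" using sum_list_remove_box by auto
  ultimately have "bij_betw ?U (diagram nu \<union> {?c}) ({1..sum_list nu} \<union> {?n})"
    by (rule bij_betw_combine)
  moreover have "{1..sum_list nu} \<union> {?n} = {1..?n}"
    using sum_list_remove_box by auto
  moreover have "diagram nu \<union> {?c} = diagram lam"
    using diagram_remove_box(1) by auto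
  ultimately have bij: "bij_betw ?U (diagram lam) {1..?n}"
    by simp
  have rows: "?U (i, j) < ?U (i, k)" if "(i, j) \<in> diagram lam" "(i, k) \<in> diagram lam" "j < k" for i j k
  proof -
    have "(i, j) \<noteq> ?c" using that by (auto simp: diagram_def)
    then have "(i, j) \<in> diagram nu"
      using that diagram_remove_box(1) by auto
    then show ?thesis
      using that U[of "(i, j)"] U[of "(i, k)"] lt[of "(i, j)"] SYT_rows[OF T, of i j k] diagram_remove_box
      by (cases "(i, k) = ?c") auto
  qed
  have cols: "?U (i, j) < ?U (k, j)" if "(i, j) \<in> diagram lam" "(k, j) \<in> diagram lam" "i < k" for i j k
  proof -
    have "(i, j) \<noteq> ?c"
    proof
      assume "(i, j) = ?c"
      then have "lam ! r \<le> lam ! k" "Suc r \<le> k" "k < length lam"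
        using that corner by (auto simp: diagram_def corner_def)
      moreover have "lam ! k \<le> lam ! Suc r"
        using sorted calculation by (cases "k = Suc r") (auto simp: sorted_wrt_iff_nth_less)
      ultimately show False using corner by (auto simp: corner_def)
    qed
    then have "(i, j) \<in> diagram nu"
      using that diagram_remove_box(1) by auto
    then show ?thesis
      using that U[of "(i, j)"] U[of "(k, j)"] lt[of "(i, j)"] SYT_cols[OF T, of i j k] diagram_remove_box
      by (cases "(k, j) = ?c") auto
  qed
  have "T \<in> extensional (diagram nu)" using T by (simp add: SYT_def)
  then have "?U \<in> extensional (diagram lam)"
    using diagram_remove_box(1) by (auto simp: extensional_def)
  then show ?thesis
    unfolding SYT_def using bij rows cols by blast
qed

lemma bij_betw_restrict_SYT:
  "bij_betw (\<lambda>T. restrict T (diagram nu)) {T \<in> SYT lam. row_of lam T (sum_list lam) = r} (SYT nu)"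
proof (rule bij_betw_byWitness[where f' = "\<lambda>T. T((r, lam ! r - 1) := sum_list lam)"], goal_cases)
  case 1
  show ?case
  proof (intro ballI)
    fix T assume "T \<in> {T \<in> SYT lam. row_of lam T (sum_list lam) = r}"
    then have T: "T \<in> SYT lam" "T (r, lam ! r - 1) = sum_list lam"
      using largest_entry(2)[of T lam r] sum_list_remove_box by auto
    then have "T \<in> extensional (insert (r, lam ! r - 1) (diagram nu))"
      using diagram_remove_box(1) by (simp add: SYT_def)
    then have "T c = undefined" if "c \<notin> insert (r, lam ! r - 1) (diagram nu)" for c
      using that by (rule extensional_arb)
    with T show "(restrict T (diagram nu))((r, lam ! r - 1) := sum_list lam) = T"
      by (intro ext) (auto simp: restrict_def)
  qed
next
  case 2
  show ?case
  proof (intro ballI ext)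
    fix T c assume "T \<in> SYT nu"
    then have "T \<in> extensional (diagram nu)" by (simp add: SYT_def)
    then have "T c = undefined" if "c \<notin> diagram nu"
      using that by (rule extensional_arb)
    then show "restrict (T((r, lam ! r - 1) := sum_list lam)) (diagram nu) c = T c"
      using diagram_remove_box(2) by (auto simp: restrict_def)
  qed
next
  case 3
  show ?case
    using largest_entry(2)[of _ lam r] sum_list_remove_box restrict_SYT by auto
next
  case 4
  show ?case
  proof clarify
    fix T assume "T \<in> SYT nu"
    then have U: "T((r, lam ! r - 1) := sum_list lam) \<in> SYT lam" by (rule extend_SYT)
    show "T((r, lam ! r - 1) := sum_list lam) \<in> SYT lam
        \<and> row_of lam (T((r, lam ! r - 1) := sum_list lam)) (sum_list lam) = r"
      using U row_of_eqI[OF U, of "(r, lam ! r - 1)"] diagram_remove_box(1) by simp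
  qed
qed

lemma maj_remove_box:
  assumes T: "T \<in> SYT lam" and top: "row_of lam T (sum_list lam) = r"
  defines "T' \<equiv> restrict T (diagram nu)"
  shows "maj lam T = maj nu T' + (if row_of nu T' (sum_list nu) < r then sum_list nu else 0)"
proof -
  let ?N = "sum_list nu" let ?c = "(r, lam ! r - 1)"
  have Tc: "T ?c = Suc ?N"
    using largest_entry(2)[OF T _ top] sum_list_remove_box by simp
  have T': "T' \<in> SYT nu"
    using restrict_SYT[OF T] Tc sum_list_remove_box by (simp add: T'_def)
  have eq: "T' c = T c" if "c \<in> diagram nu" for c
    using that by (simp add: T'_def)
  \<comment> \<open>The only descent that can involve the removed cell. The condition
    \<open>0 < ?N\<close> excludes the arbitrary row of the entry 0.\<close>
  define E where "E = {d. d = ?N \<and> 0 < ?N \<and> row_of nu T' ?N < r}"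
  have "descents lam T = descents nu T' \<union> E"
  proof (intro equalityI subsetI)
    fix d assume "d \<in> descents lam T"
    then obtain c1 c2 where c: "c1 \<in> diagram lam" "c2 \<in> diagram lam" "T c1 = d" "T c2 = Suc d" "fst c1 < fst c2"
      by (auto simp: descents_def)
    have "Suc d \<le> Suc ?N" "0 < d" using SYT_range[OF T c(2)] SYT_range[OF T c(1)] c sum_list_remove_box by auto
    then have c1: "c1 \<in> diagram nu"
      using c(1,3) Tc diagram_remove_box(1) by auto
    show "d \<in> descents nu T' \<union> E"
    proof (cases "c2 = ?c")
      case True
      then have "d = ?N" using c Tc by simp
      moreover have "row_of nu T' ?N = fst c1"
        using row_of_eqI[OF T' c1] eq[OF c1] c \<open>d = ?N\<close> by simp
      ultimately show ?thesis using True c \<open>0 < d\<close> by (simp add: E_def)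
    next
      case False
      then have "c2 \<in> diagram nu" using c(2) diagram_remove_box(1) by auto
      then have "d \<in> descents nu T'"
        unfolding descents_def using c c1 eq[of c1] eq[of c2]
        by (intro CollectI bexI[where x = c1] bexI[where x = c2]) auto
      then show ?thesis ..
    qed
  next
    fix d assume "d \<in> descents nu T' \<union> E"
    then show "d \<in> descents lam T"
    proof
      assume "d \<in> descents nu T'"
      then obtain c1 c2 where c: "c1 \<in> diagram nu" "c2 \<in> diagram nu" "T' c1 = d" "T' c2 = d + 1" "fst c1 < fst c2"
        by (auto simp: descents_def)
      then show ?thesis
        unfolding descents_def using eq[of c1] eq[of c2] diagram_remove_box(1)
        by (intro CollectI bexI[where x = c1] bexI[where x = c2]) auto
    next
      assume d: "d \<in> E"
      then obtain j where "(row_of nu T' ?N, j) \<in> diagram nu" "T' (row_of nu T' ?N, j) = ?N"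
        using row_of_cell[OF T', of ?N] by (auto simp: E_def Suc_le_eq)
      then show ?thesis
        using d Tc diagram_remove_box(1) eq unfolding descents_def E_def
        by (intro CollectI bexI[where x = "(row_of nu T' ?N, j)"] bexI[where x = ?c]) auto
    qed
  qed
  moreover have "descents nu T' \<inter> E = {}"
    using SYT_range[OF T'] by (fastforce simp: descents_def E_def)
  moreover have "finite (descents nu T')"
  proof (rule finite_subset)
    show "descents nu T' \<subseteq> T' ` diagram nu" by (auto simp: descents_def)
  qed (simp add: finite_diagram)
  moreover have "finite E" by (simp add: E_def)
  ultimately have "maj lam T = maj nu T' + \<Sum>E"
    by (simp add: maj_def sum.union_disjoint)
  also have "\<Sum>E = (if row_of nu T' ?N < r then ?N else 0)"
  proof (cases "0 < ?N \<and> row_of nu T' ?N < r")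
    case True
    then have "E = {?N}" by (auto simp: E_def)
    with True show ?thesis by simp
  next
    case False
    then have "E = {}" by (auto simp: E_def)
    with False show ?thesis by auto
  qed
  finally show ?thesis .
qed

lemma sorted_remove_box: "sorted_wrt (\<ge>) nu"
proof -
  have "nu ! k \<le> nu ! i" if "i < k" "k < length lam" for i k
  proof (cases "i = r")
    case True
    then have "lam ! k \<le> lam ! Suc r"
      using sorted that by (cases "k = Suc r") (auto simp: sorted_wrt_iff_nth_less)
    then show ?thesis
      using True that corner by (auto simp: nu_def remove_box_def corner_def)
  next
    case False
    have "lam ! k \<le> lam ! i" using sorted that by (auto simp: sorted_wrt_iff_nth_less)
    then show ?thesis
      using False that by (cases "k = r") (auto simp: nu_def remove_box_def)
  qed
  then show ?thesis
    by (simp add: sorted_wrt_iff_nth_less nu_def remove_box_def)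
qed

end

section \<open>The generating function of the major index\<close>

definition maj_gf :: "'a::comm_ring_1 \<Rightarrow> nat list \<Rightarrow> 'a" where
  "maj_gf q lam = (\<Sum>T\<in>SYT lam. q ^ maj lam T)"

definition row_gf :: "'a::comm_ring_1 \<Rightarrow> nat list \<Rightarrow> nat \<Rightarrow> 'a" where
  "row_gf q lam r = (\<Sum>T | T \<in> SYT lam \<and> row_of lam T (sum_list lam) = r. q ^ maj lam T)"

text \<open>These are the tableaux for which a new largest entry in row \<open>r\<close> creates no
  descent.\<close>

definition tail_gf :: "'a::comm_ring_1 \<Rightarrow> nat list \<Rightarrow> nat \<Rightarrow> 'a" where
  "tail_gf q lam r = (\<Sum>T | T \<in> SYT lam \<and> r \<le> row_of lam T (sum_list lam). q ^ maj lam T)"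

text \<open>For a partition into positive parts these are the hook lengths of the first column.\<close>

definition shifted :: "nat list \<Rightarrow> nat \<Rightarrow> nat" where
  "shifted lam i = lam ! i + (length lam - Suc i)"

lemma tail_gf_eq_sum:
  assumes n: "0 < sum_list lam"
  shows "tail_gf q lam r = (\<Sum>i=r..<length lam. row_gf q lam i)"
proof -
  have "{T \<in> SYT lam. r \<le> row_of lam T (sum_list lam)}
      = (\<Union>i\<in>{r..<length lam}. {T \<in> SYT lam. row_of lam T (sum_list lam) = i})"
    using row_of_less[of _ lam] n by auto
  then have "tail_gf q lam r
      = (\<Sum>T\<in>(\<Union>i\<in>{r..<length lam}. {T \<in> SYT lam. row_of lam T (sum_list lam) = i}). q ^ maj lam T)"
    by (simp add: tail_gf_def)
  also have "\<dots> = (\<Sum>i=r..<length lam. row_gf q lam i)"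
    unfolding row_gf_def
    by (rule sum.UNION_disjoint) (auto intro: finite_subset[OF _ finite_SYT[of lam]])
  finally show ?thesis .
qed

text \<open>All smaller tableaux are given the weight \<open>q ^ N\<close> of a descent at
  \<open>N\<close>; the second term corrects this for those whose entry \<open>N\<close> does not
  lie above row \<open>r\<close>.\<close>

lemma row_gf_corner:
  assumes "sorted_wrt (\<ge>) lam" and "corner lam r"
  defines "nu \<equiv> remove_box lam r"
  shows "row_gf q lam r = q ^ sum_list nu * maj_gf q nu + (1 - q ^ sum_list nu) * tail_gf q nu r"
proof -
  let ?N = "sum_list nu"
  let ?S = "{T \<in> SYT lam. row_of lam T (sum_list lam) = r}"
  define g where "g T = q ^ (maj nu T + (if row_of nu T ?N < r then ?N else 0))" for T
  have "row_gf q lam r = (\<Sum>T\<in>?S. g (restrict T (diagram nu)))"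
    unfolding row_gf_def g_def nu_def
    by (intro sum.cong refl) (use maj_remove_box[OF assms(1,2)] in auto)
  also have "\<dots> = (\<Sum>T\<in>SYT nu. g T)"
    unfolding nu_def by (rule sum.reindex_bij_betw[OF bij_betw_restrict_SYT[OF assms(1,2)]])
  also have "\<dots> = (\<Sum>T\<in>SYT nu. q ^ ?N * q ^ maj nu T
      + (1 - q ^ ?N) * (if r \<le> row_of nu T ?N then q ^ maj nu T else 0))"
    by (intro sum.cong refl) (auto simp: g_def power_add algebra_simps)
  also have "\<dots> = q ^ ?N * maj_gf q nu + (1 - q ^ ?N) * tail_gf q nu r"
    by (simp add: sum.distrib sum_distrib_left[symmetric] maj_gf_def tail_gf_def
        sum.inter_filter finite_SYT)
  finally show ?thesis .
qed

lemma row_gf_not_corner: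
  assumes "0 < sum_list lam" and "\<not> corner lam r"
  shows "row_gf q lam r = 0"
proof -
  have "{T \<in> SYT lam. row_of lam T (sum_list lam) = r} = {}"
    using largest_entry(1)[OF _ assms(1)] assms(2) by auto
  then show ?thesis unfolding row_gf_def by (simp only: sum.empty)
qed

lemma shift_det_cong: "(\<And>i. i < m \<Longrightarrow> l i = l' i) \<Longrightarrow> shift_det m q l r = shift_det m q l' r"
proof -
  assume l: "\<And>i. i < m \<Longrightarrow> l i = l' i"
  have "mat m m (\<lambda>(i, j). shift_entry q l r i j) = mat m m (\<lambda>(i, j). shift_entry q l' r i j)"
    by (rule eq_matI) (auto simp: shift_entry_def l)
  moreover have "(\<Prod>i<m. qfac q (l i)) = (\<Prod>i<m. qfac q (l' i))"
    by (rule prod.cong) (auto simp: l)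
  ultimately show ?thesis by (simp add: shift_det_def)
qed

lemma shifted_remove_box:
  assumes "corner lam r" "i < length lam"
  shows "shifted (remove_box lam r) i = ((shifted lam)(r := shifted lam r - 1)) i"
  using assms by (auto simp: shifted_def remove_box_def corner_def)

text \<open>If row \<open>r\<close> is not a corner, either its shifted part is 0 or the next row
  has the same length. In the latter case lowering the shifted part makes it equal to the next one,
  and two undifferenced rows coincide.\<close>

lemma shift_det_shifted_step:
  fixes q :: "'a::field"
  assumes "sorted_wrt (\<ge>) lam" "r < length lam" "\<And>k. 0 < k \<Longrightarrow> k \<le> shifted lam r \<Longrightarrow> q ^ k \<noteq> 1"
  shows "shift_det (length lam) q (shifted lam) r - shift_det (length lam) q (shifted lam) (Suc r)
       = (if corner lam r then shift_det (length lam) q (shifted (remove_box lam r)) r else 0)"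
proof -
  let ?m = "length lam" and ?l = "shifted lam"
  have step: "shift_det ?m q ?l r - shift_det ?m q ?l (Suc r) = (if ?l r = 0 then 0 else shift_det ?m q (?l(r := ?l r - 1)) r)"
    using assms(2,3) by (intro shift_det_step) auto
  show ?thesis
  proof (cases "corner lam r")
    case True
    then have "?l r \<noteq> 0" by (auto simp: shifted_def corner_def)
    moreover have "shift_det ?m q (?l(r := ?l r - 1)) r = shift_det ?m q (shifted (remove_box lam r)) r"
      by (rule shift_det_cong) (simp add: shifted_remove_box True)
    ultimately show ?thesis using step True by simp
  next
    case False
    have "shift_det ?m q (?l(r := ?l r - 1)) r = 0" if "?l r \<noteq> 0"
    proof -
      have r: "Suc r < ?m"
        using False that assms(2) by (auto simp: corner_def shifted_def)
      moreover have "lam ! Suc r \<le> lam ! r"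
        using assms(1) r by (auto simp: sorted_wrt_iff_nth_less)
      ultimately have "lam ! Suc r = lam ! r"
        using False by (auto simp: corner_def)
      then show ?thesis
        using r by (intro shift_det_identical[of r r "Suc r"]) (auto simp: shifted_def)
    qed
    with step False show ?thesis by auto
  qed
qed

lemma sum_shifted: "(\<Sum>i<length lam. shifted lam i) = sum_list lam + (\<Sum>i<length lam. i)"
  using sum.nat_diff_reindex[of "\<lambda>i. i" "length lam"]
  unfolding shifted_def sum.distrib by (simp add: sum_list_sum_nth atLeast0LessThan)

lemma shift_det_shifted_top: "shift_det (length lam) q (shifted lam) (length lam)
    = q ^ sum_list lam * shift_det (length lam) q (shifted lam) 0"
  by (simp add: shift_det_top shift_det_0 sum_shifted power_add)

lemma maj_gf_size_0:
  assumes "sum_list lam = 0"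
  shows "maj_gf q lam = 1"
proof -
  have d: "diagram lam = {}"
    using card_diagram[of lam] finite_diagram[of lam] assms by simp
  have "SYT lam = {\<lambda>_. undefined}"
    using assms d unfolding SYT_def by (auto simp: bij_betw_def)
  then show ?thesis by (simp add: maj_gf_def maj_def descents_def d)
qed

text \<open>Deleting the largest entry \<open>N + 1\<close> lowers the major index by \<open>N\<close> exactly if \<open>N\<close> lies in a higher
  row, so \<^const>\<open>row_gf\<close> of a shape is determined by \<^const>\<open>maj_gf\<close> and \<^const>\<open>tail_gf\<close> of a smaller
  one; hence the two identities have to be proved together.\<close>

proposition maj_gf_shift_det:
  fixes q :: "'a::field"
  assumes "sorted_wrt (\<ge>) lam"
    and "\<And>i. i < length lam \<Longrightarrow> shifted lam i \<le> B" and "sum_list lam \<le> B"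
    and q: "\<And>k. 0 < k \<Longrightarrow> k \<le> B \<Longrightarrow> q ^ k \<noteq> 1"
  shows "maj_gf q lam * shift_det (length lam) q (\<lambda>i. length lam - Suc i) 0
      = qfac q (sum_list lam) * shift_det (length lam) q (shifted lam) 0
    \<and> (\<forall>r\<le>length lam. (1 - q ^ sum_list lam) * tail_gf q lam r * shift_det (length lam) q (\<lambda>i. length lam - Suc i) 0
      = qfac q (sum_list lam) * (shift_det (length lam) q (shifted lam) r - shift_det (length lam) q (shifted lam) (length lam)))"
  using assms(1-3)
proof (induction "sum_list lam" arbitrary: lam rule: less_induct)
  case less
  let ?m = "length lam" and ?l = "shifted lam" and ?n = "sum_list lam"
  \<comment> \<open>The value of \<open>F\<close> at the shape with \<open>?m\<close> empty rows,
    which normalizes the recursion.\<close>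
  let ?c = "shift_det ?m q (\<lambda>i. ?m - Suc i) 0"
  have row: "(1 - q ^ ?n) * row_gf q lam i * ?c = qfac q ?n * (shift_det ?m q ?l i - shift_det ?m q ?l (Suc i))"
    if i: "i < ?m" for i
  proof -
    have step: "shift_det ?m q ?l i - shift_det ?m q ?l (Suc i) = (if corner lam i then shift_det ?m q (shifted (remove_box lam i)) i else 0)"
      using less.prems i q by (intro shift_det_shifted_step) (auto intro: order_trans)
    show ?thesis
    proof (cases "corner lam i")
      case True
      define nu where "nu = remove_box lam i"
      have len: "length nu = ?m" by (simp add: nu_def remove_box_def)
      have n: "?n = Suc (sum_list nu)"
        unfolding nu_def by (rule sum_list_remove_box[OF less.prems(1) True])
      have sorted: "sorted_wrt (\<ge>) nu"
        unfolding nu_def by (rule sorted_remove_box[OF less.prems(1) True])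
      have bound: "shifted nu k \<le> B" if "k < length nu" for k
        using less.prems(2)[of k] less.prems(2)[of i] that len i shifted_remove_box[OF True, of k]
        by (auto simp: nu_def split: if_splits)
      let ?z = "shift_det ?m q (shifted nu)"
      have IH1: "maj_gf q nu * ?c = qfac q (sum_list nu) * ?z 0"
        using less.hyps[of nu] n len sorted bound less.prems(3) by simp
      have IH2: "(1 - q ^ sum_list nu) * tail_gf q nu i * ?c = qfac q (sum_list nu) * (?z i - ?z ?m)"
        using less.hyps[of nu] n len sorted bound less.prems(3) i by simp
      have "row_gf q lam i * ?c = q ^ sum_list nu * (maj_gf q nu * ?c) + (1 - q ^ sum_list nu) * tail_gf q nu i * ?c"
        unfolding nu_def by (subst row_gf_corner[OF less.prems(1) True]) (simp add: algebra_simps)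
      \<comment> \<open>Since \<open>?z ?m\<close> is \<open>q ^ sum_list nu\<close> times
        \<open>?z 0\<close>, the terms at 0 and \<open>?m\<close> cancel and \<open>?z i\<close>
        remains.\<close>
      also have "\<dots> = qfac q (sum_list nu) * ?z i"
        unfolding IH1 IH2 using shift_det_shifted_top[of nu q] len by (simp add: algebra_simps)
      finally have "row_gf q lam i * ?c = qfac q (sum_list nu) * ?z i" .
      then have "(1 - q ^ ?n) * (row_gf q lam i * ?c) = qfac q ?n * ?z i"
        unfolding n qfac_Suc by simp
      then show ?thesis
        using step True by (simp add: nu_def mult.assoc)
    next
      case False
      \<comment> \<open>For size 0 the factor vanishes; otherwise no tableau has its largest entry
        in row \<open>i\<close>.\<close>
      then have "(1 - q ^ ?n) * row_gf q lam i = 0"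
        using row_gf_not_corner[of lam i q] by (cases "?n = 0") (simp_all only: power_0, auto)
      then show ?thesis
        using step False by simp
    qed
  qed
  have tail: "(1 - q ^ ?n) * tail_gf q lam r * ?c = qfac q ?n * (shift_det ?m q ?l r - shift_det ?m q ?l ?m)"
    if r: "r \<le> ?m" for r
  proof -
    have "(1 - q ^ ?n) * tail_gf q lam r = (\<Sum>i=r..<?m. (1 - q ^ ?n) * row_gf q lam i)"
      using tail_gf_eq_sum[of lam q r]
      by (cases "?n = 0") (simp_all only: power_0 diff_self mult_zero_left sum.neutral_const sum_distrib_left neq0_conv)
    then have "(1 - q ^ ?n) * tail_gf q lam r * ?c = (\<Sum>i=r..<?m. (1 - q ^ ?n) * row_gf q lam i * ?c)"
      by (simp add: sum_distrib_right)
    also have "\<dots> = (\<Sum>i=r..<?m. qfac q ?n * (shift_det ?m q ?l i - shift_det ?m q ?l (Suc i)))"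
      by (intro sum.cong refl) (simp add: row)
    also have "\<dots> = qfac q ?n * (shift_det ?m q ?l r - shift_det ?m q ?l ?m)"
      using sum_Suc_diff'[OF r, of "\<lambda>i. - shift_det ?m q ?l i"] by (simp add: sum_distrib_left[symmetric])
    finally show ?thesis .
  qed
  have "maj_gf q lam * ?c = qfac q ?n * shift_det ?m q ?l 0"
    proof (cases "?n = 0")
      case True
      then have "lam ! i = 0" if "i < ?m" for i using that by simp
      then have "shift_det ?m q ?l 0 = ?c"
        by (intro shift_det_cong) (auto simp: shifted_def)
      then show ?thesis using maj_gf_size_0[OF True, of q] unfolding True by simp
    next
      case False
      \<comment> \<open>The tail at 0 counts all tableaux, and the eigenvalue turns the difference
        of the two extreme determinants into a multiple of \<open>1 - q ^ ?n\<close>, which can be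
        divided out.\<close>
      have "tail_gf q lam 0 = maj_gf q lam" by (simp add: tail_gf_def maj_gf_def)
      then have "(1 - q ^ ?n) * (maj_gf q lam * ?c) = (1 - q ^ ?n) * (qfac q ?n * shift_det ?m q ?l 0)"
        using tail[of 0] shift_det_shifted_top[of lam q] by (simp add: algebra_simps)
      moreover have "1 - q ^ ?n \<noteq> 0" using q[of ?n] False less.prems(3) by simp
      ultimately show ?thesis by simp
    qed
  with tail show ?case by blast
qed

section \<open>The hook length formula\<close>

text \<open>In row \<open>i\<close> the hook lengths and the gaps \<open>l i - l k\<close> with
  \<open>k > i\<close> partition \<open>{1..l i}\<close>; this classical fact serves as the
  definition. A set suffices because hook lengths within a row are distinct.\<close>

definition hooks :: "nat \<Rightarrow> (nat \<Rightarrow> nat) \<Rightarrow> nat \<Rightarrow> nat set" where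
  "hooks m l i = {1..l i} - (\<lambda>k. l i - l k) ` {i<..<m}"

lemma finite_hooks: "finite (hooks m l i)"
  by (simp add: hooks_def)

context
  fixes m :: nat and l :: "nat \<Rightarrow> nat"
  assumes dec: "\<And>i k. i < k \<Longrightarrow> k < m \<Longrightarrow> l k < l i"
begin

lemma inj_on_hook_gaps: "inj_on (\<lambda>k. l i - l k) {i<..<m}"
proof (rule inj_onI)
  fix k k' assume "k \<in> {i<..<m}" "k' \<in> {i<..<m}" "l i - l k = l i - l k'"
  then show "k = k'"
    using dec[of i k] dec[of i k'] dec[of k k'] dec[of k' k] by (cases k k' rule: linorder_cases) auto
qed

lemma hook_gaps_subset: "(\<lambda>k. l i - l k) ` {i<..<m} \<subseteq> {1..l i}"
  using dec by (fastforce simp: Suc_le_eq)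

lemma card_hooks: "card (hooks m l i) = l i - (m - Suc i)"
  unfolding hooks_def using hook_gaps_subset[of i]
  by (subst card_Diff_subset) (auto simp: card_image inj_on_hook_gaps)

lemma prod_hooks:
  "(\<Prod>h\<in>hooks m l i. f h) * (\<Prod>k\<in>{i<..<m}. f (l i - l k)) = (\<Prod>h=1..l i. f h :: 'a::comm_monoid_mult)"
proof -
  have "(\<Prod>h=1..l i. f h) = (\<Prod>h\<in>hooks m l i. f h) * (\<Prod>h\<in>(\<lambda>k. l i - l k) ` {i<..<m}. f h)"
    unfolding hooks_def by (rule prod.subset_diff[OF hook_gaps_subset]) simp
  then show ?thesis by (simp add: prod.reindex inj_on_hook_gaps)
qed

lemma sum_hooks:
  "(\<Sum>h\<in>hooks m l i. f h) + (\<Sum>k\<in>{i<..<m}. f (l i - l k)) = (\<Sum>h=1..l i. f h :: 'a::comm_monoid_add)"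
proof -
  have "(\<Sum>h=1..l i. f h) = (\<Sum>h\<in>hooks m l i. f h) + (\<Sum>h\<in>(\<lambda>k. l i - l k) ` {i<..<m}. f h)"
    unfolding hooks_def by (rule sum.subset_diff[OF hook_gaps_subset]) simp
  then show ?thesis by (simp add: sum.reindex inj_on_hook_gaps)
qed

text \<open>Each Vandermonde factor is a power of \<open>q\<close> times \<open>1 - q ^ gap\<close>.
  The gaps cancel against the q-factorials and leave the hooks.\<close>

lemma shift_det_eq_hooks:
  fixes q :: "'a::field"
  assumes "\<And>k i. i < m \<Longrightarrow> 0 < k \<Longrightarrow> k \<le> l i \<Longrightarrow> q ^ k \<noteq> 1"
  shows "shift_det m q l 0 = q ^ (\<Sum>i<m. i) * q ^ (\<Sum>i<m. i * l i) / (\<Prod>i<m. \<Prod>h\<in>hooks m l i. 1 - q ^ h)"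
proof -
  let ?P = "\<Prod>i<m. \<Prod>k\<in>{i<..<m}. 1 - q ^ (l i - l k)"
  let ?H = "\<Prod>i<m. \<Prod>h\<in>hooks m l i. 1 - q ^ h"
  have "vandermonde m (\<lambda>i. q ^ l i) = (\<Prod>j<m. \<Prod>k<j. q ^ l j * (1 - q ^ (l k - l j)))"
    unfolding vandermonde_eq_prod
  proof (intro prod.cong refl)
    fix j k assume "j \<in> {..<m}" "k \<in> {..<j}"
    then have "l j \<le> l k" using dec[of k j] by simp
    then show "q ^ l j - q ^ l k = q ^ l j * (1 - q ^ (l k - l j))"
      by (simp add: right_diff_distrib power_add[symmetric])
  qed
  also have "\<dots> = (\<Prod>j<m. q ^ (j * l j)) * (\<Prod>j<m. \<Prod>k<j. 1 - q ^ (l k - l j))"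
    by (simp add: prod.distrib power_mult[symmetric] mult.commute)
  also have "(\<Prod>j<m. \<Prod>k<j. 1 - q ^ (l k - l j))
      = (\<Prod>j<m. \<Prod>k\<in>{k. k \<in> {..<m} \<and> k < j}. 1 - q ^ (l k - l j))"
    by (intro prod.cong) auto
  also have "\<dots> = (\<Prod>k<m. \<Prod>j\<in>{j. j \<in> {..<m} \<and> k < j}. 1 - q ^ (l k - l j))"
    by (rule prod.swap_restrict) auto
  also have "\<dots> = ?P"
    by (intro prod.cong) auto
  finally have vand: "vandermonde m (\<lambda>i. q ^ l i) = q ^ (\<Sum>j<m. j * l j) * ?P"
    by (simp add: power_sum)
  have "(\<Prod>i<m. qfac q (l i)) = (\<Prod>i<m. (\<Prod>h\<in>hooks m l i. 1 - q ^ h) * (\<Prod>k\<in>{i<..<m}. 1 - q ^ (l i - l k)))"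
    unfolding qfac_def by (intro prod.cong refl) (rule prod_hooks[symmetric])
  then have denom: "(\<Prod>i<m. qfac q (l i)) = ?H * ?P"
    by (simp add: prod.distrib)
  have "?P \<noteq> 0"
  proof -
    have "1 - q ^ (l i - l k) \<noteq> 0" if "i < m" "i < k" "k < m" for i k
      using assms[of i "l i - l k"] dec[of i k] that by auto
    then show ?thesis by auto
  qed
  then show ?thesis
    unfolding shift_det_0 denom vand by simp
qed

end

abbreviation hook_lengths :: "nat list \<Rightarrow> nat \<Rightarrow> nat set" where
  "hook_lengths lam \<equiv> hooks (length lam) (shifted lam)"

lemma shifted_strict:
  assumes "sorted_wrt (\<ge>) lam" "i < k" "k < length lam"
  shows "shifted lam k < shifted lam i"
proof -
  have "lam ! k \<le> lam ! i" using assms by (auto simp: sorted_wrt_iff_nth_less)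
  then show ?thesis using assms by (auto simp: shifted_def)
qed

text \<open>The determinants of the shape and of the empty shape are both evaluated by hooks, and
  the empty shape has none. The separate bound \<open>B\<close> is due to zero parts, with which a
  shifted part may exceed the size.\<close>

theorem maj_gf_hook_formula:
  fixes q :: "'a::field"
  assumes sorted: "sorted_wrt (\<ge>) lam"
    and B: "\<And>i. i < length lam \<Longrightarrow> shifted lam i \<le> B" "sum_list lam \<le> B"
    and q: "\<And>k. 0 < k \<Longrightarrow> k \<le> B \<Longrightarrow> q ^ k \<noteq> 1" "q \<noteq> 0"
  shows "maj_gf q lam = q ^ (\<Sum>i<length lam. i * lam ! i) * qfac q (sum_list lam)
           / (\<Prod>i<length lam. \<Prod>h\<in>hook_lengths lam i. 1 - q ^ h)"
proof -
  let ?m = "length lam"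
  let ?l0 = "\<lambda>i. ?m - Suc i"
  let ?H = "\<Prod>i<?m. \<Prod>h\<in>hook_lengths lam i. 1 - q ^ h"
  have small: "q ^ k \<noteq> 1" if "i < ?m" "0 < k" "k \<le> shifted lam i" for k i
    using q(1)[of k] B(1)[of i] that by simp
  have Z: "shift_det ?m q (shifted lam) 0 = q ^ (\<Sum>i<?m. i) * q ^ (\<Sum>i<?m. i * shifted lam i) / ?H"
    by (rule shift_det_eq_hooks) (use shifted_strict[OF sorted] small in auto)
  have "hooks ?m ?l0 i = {}" if "i < ?m" for i
  proof -
    have "card (hooks ?m ?l0 i) = 0"
      by (subst card_hooks) auto
    then show ?thesis using finite_hooks[of ?m ?l0] by (auto simp: hooks_def)
  qed
  moreover have "shift_det ?m q ?l0 0 = q ^ (\<Sum>i<?m. i) * q ^ (\<Sum>i<?m. i * ?l0 i)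
      / (\<Prod>i<?m. \<Prod>h\<in>hooks ?m ?l0 i. 1 - q ^ h)"
  proof (rule shift_det_eq_hooks)
    show "q ^ k \<noteq> 1" if "i < ?m" "0 < k" "k \<le> ?m - Suc i" for k i
      using small[of i k] that by (auto simp: shifted_def)
  qed auto
  ultimately have c: "shift_det ?m q ?l0 0 = q ^ (\<Sum>i<?m. i) * q ^ (\<Sum>i<?m. i * ?l0 i)"
    by simp
  have "(\<Sum>i<?m. i * shifted lam i) = (\<Sum>i<?m. i * lam ! i) + (\<Sum>i<?m. i * ?l0 i)"
    by (simp only: shifted_def sum.distrib[symmetric] distrib_left)
  then have "shift_det ?m q (shifted lam) 0 = shift_det ?m q ?l0 0 * (q ^ (\<Sum>i<?m. i * lam ! i) / ?H)"
    unfolding Z c by (simp add: power_add)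
  moreover have "maj_gf q lam * shift_det ?m q ?l0 0 = qfac q (sum_list lam) * shift_det ?m q (shifted lam) 0"
    using maj_gf_shift_det[OF sorted B q(1)] by simp
  ultimately have "maj_gf q lam * shift_det ?m q ?l0 0
      = q ^ (\<Sum>i<?m. i * lam ! i) * qfac q (sum_list lam) / ?H * shift_det ?m q ?l0 0"
    by (simp add: mult_ac)
  moreover have c_nz: "shift_det ?m q ?l0 0 \<noteq> 0"
    unfolding c using q(2) by simp
  ultimately show ?thesis by (simp only: mult_right_cancel[OF c_nz])
qed

section \<open>Contents and the sum of squared hook lengths\<close>

text \<open>A cell is encoded as its row and its hook length, so \<open>snd\<close> is the hook
  length and not the column.\<close>

definition hook_cells :: "nat list \<Rightarrow> (nat \<times> nat) set" where
  "hook_cells lam = (SIGMA i:{..<length lam}. hook_lengths lam i)"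

text \<open>The variance of \<^const>\<open>maj\<close>; the factor \<open>1 / 12\<close> is that of uniform distributions.\<close>

definition hook_variance :: "nat list \<Rightarrow> real" where
  "hook_variance lam = ((\<Sum>j=1..sum_list lam. (real j)\<^sup>2) - (\<Sum>c\<in>hook_cells lam. (real (snd c))\<^sup>2)) / 12"

text \<open>As a polynomial identity, its difference at \<open>x\<close> and \<open>x - 1\<close> is
  the square of \<open>x\<close> for every real \<open>x\<close>; contents can be negative.\<close>

definition square_pyramid :: "real \<Rightarrow> real" where
  "square_pyramid x = x * (x + 1) * (2 * x + 1) / 6"

lemma sum_squares: "(\<Sum>j=1..n. (real j)\<^sup>2) = square_pyramid (real n)"
  by (induction n) (auto simp: square_pyramid_def power2_eq_square algebra_simps add_divide_distrib)

lemma sum_squares_lessThan: "(\<Sum>j<n. (real j)\<^sup>2) = square_pyramid (real n) - (real n)\<^sup>2"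
  by (induction n) (auto simp: square_pyramid_def power2_eq_square field_simps)

lemma sum_contents_row:
  "(\<Sum>j<p. (real j - x)\<^sup>2) = square_pyramid (real p - 1 - x) - square_pyramid (- x - 1)"
  by (induction p) (auto simp: square_pyramid_def power2_eq_square field_simps)

lemma sum_square_differences:
  fixes L :: "nat \<Rightarrow> real"
  shows "(\<Sum>k<m. \<Sum>i<k. (L i - L k)\<^sup>2) = real m * (\<Sum>i<m. (L i)\<^sup>2) - (\<Sum>i<m. L i)\<^sup>2"
proof (induction m)
  case (Suc m)
  have "(\<Sum>i<m. (L i - L m)\<^sup>2) = (\<Sum>i<m. (L i)\<^sup>2) + real m * (L m)\<^sup>2 - 2 * L m * (\<Sum>i<m. L i)"
    by (simp add: power2_diff sum.distrib sum_subtractf sum_distrib_left mult_ac)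
  with Suc show ?case by (simp add: power2_eq_square algebra_simps)
qed simp

lemma sum_square_pyramid_negative:
  "(\<Sum>i<m. square_pyramid (- real i - 1))
     = (real m)\<^sup>2 * (real m - 1)\<^sup>2 / 4 + real m * square_pyramid (- real m)"
  by (induction m) (auto simp: square_pyramid_def power2_eq_square field_simps)

text \<open>Row by row both sums are values of the cubic \<open>square_pyramid\<close> at shifted
  parts, up to the squared gaps. Cubic and quadratic terms in the shifted parts cancel, so only
  their sum \<open>n + m (m - 1) / 2\<close> matters.\<close>

lemma sum_hook_squares:
  assumes sorted: "sorted_wrt (\<ge>) lam"
  shows "(\<Sum>c\<in>hook_cells lam. (real (snd c))\<^sup>2)
       = (real (sum_list lam))\<^sup>2 + (\<Sum>(i, j)\<in>diagram lam. (real j - real i)\<^sup>2)"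
proof -
  define m where "m = length lam"
  define l where "l = shifted lam"
  define L where "L i = real (l i)" for i
  define n where "n = real (sum_list lam)"
  define P where "P = (\<Sum>i<m. (L i)\<^sup>2)"
  have dec: "l k < l i" if "i < k" "k < m" for i k
    using shifted_strict[OF sorted] that by (simp add: l_def m_def)
  have P1: "(\<Sum>i<m. L i) = n + real m * (real m - 1) / 2"
  proof -
    have "(\<Sum>i<m. real i) = real m * (real m - 1) / 2"
      by (induction m) (auto simp: field_simps)
    moreover have "(\<Sum>i<m. L i) = n + (\<Sum>i<m. real i)"
      using arg_cong[OF sum_shifted[of lam], of real] by (simp add: L_def l_def n_def m_def)
    ultimately show ?thesis by simp
  qed
  have row: "(\<Sum>h\<in>hooks m l i. (real h)\<^sup>2) = square_pyramid (L i) - (\<Sum>k\<in>{i<..<m}. (L i - L k)\<^sup>2)" for i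
  proof -
    have "(\<Sum>h\<in>hooks m l i. (real h)\<^sup>2) + (\<Sum>k\<in>{i<..<m}. (real (l i - l k))\<^sup>2) = square_pyramid (L i)"
      unfolding L_def sum_squares[symmetric] by (rule sum_hooks) (rule dec)
    moreover have "(\<Sum>k\<in>{i<..<m}. (real (l i - l k))\<^sup>2) = (\<Sum>k\<in>{i<..<m}. (L i - L k)\<^sup>2)"
      using dec[of i] by (intro sum.cong refl) (simp add: L_def of_nat_diff less_imp_le)
    ultimately show ?thesis by simp
  qed
  have "(\<Sum>i<m. \<Sum>k\<in>{i<..<m}. (L i - L k)\<^sup>2) = (\<Sum>i<m. \<Sum>k\<in>{k. k \<in> {..<m} \<and> i < k}. (L i - L k)\<^sup>2)"
    by (intro sum.cong) auto
  also have "\<dots> = (\<Sum>k<m. \<Sum>i\<in>{i. i \<in> {..<m} \<and> i < k}. (L i - L k)\<^sup>2)"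
    by (rule sum.swap_restrict) auto
  also have "\<dots> = (\<Sum>k<m. \<Sum>i<k. (L i - L k)\<^sup>2)"
    by (intro sum.cong) auto
  finally have gaps: "(\<Sum>i<m. \<Sum>k\<in>{i<..<m}. (L i - L k)\<^sup>2) = real m * P - (\<Sum>i<m. L i)\<^sup>2"
    by (simp add: sum_square_differences P_def)
  have "(\<Sum>c\<in>hook_cells lam. (real (snd c))\<^sup>2) = (\<Sum>i<m. \<Sum>h\<in>hooks m l i. (real h)\<^sup>2)"
    unfolding hook_cells_def m_def l_def
    by (subst sum.Sigma) (auto simp: finite_hooks split_def)
  also have "\<dots> = (\<Sum>i<m. square_pyramid (L i)) - (\<Sum>i<m. \<Sum>k\<in>{i<..<m}. (L i - L k)\<^sup>2)"
    by (simp add: row sum_subtractf)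
  finally have hooks: "(\<Sum>c\<in>hook_cells lam. (real (snd c))\<^sup>2)
      = (\<Sum>i<m. square_pyramid (L i)) - (real m * P - (\<Sum>i<m. L i)\<^sup>2)"
    using gaps by simp
  have "diagram lam = (SIGMA i:{..<m}. {..<lam ! i})"
    by (auto simp: diagram_def m_def)
  then have "(\<Sum>(i, j)\<in>diagram lam. (real j - real i)\<^sup>2) = (\<Sum>i<m. \<Sum>j<lam ! i. (real j - real i)\<^sup>2)"
    by (simp add: sum.Sigma split_def)
  also have "\<dots> = (\<Sum>i<m. square_pyramid (L i - real m) - square_pyramid (- real i - 1))"
  proof (intro sum.cong refl)
    fix i assume "i \<in> {..<m}"
    then have "real (lam ! i) - 1 - real i = L i - real m"
      by (simp add: L_def l_def shifted_def m_def of_nat_diff)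
    then show "(\<Sum>j<lam ! i. (real j - real i)\<^sup>2) = square_pyramid (L i - real m) - square_pyramid (- real i - 1)"
      unfolding sum_contents_row by simp
  qed
  also have "\<dots> = (\<Sum>i<m. square_pyramid (L i) - real m * (L i)\<^sup>2 + ((real m)\<^sup>2 - real m) * L i
      + square_pyramid (- real m) - square_pyramid (- real i - 1))"
    by (intro sum.cong refl) (simp add: square_pyramid_def power2_eq_square field_simps)
  also have "\<dots> = (\<Sum>i<m. square_pyramid (L i)) - real m * P + ((real m)\<^sup>2 - real m) * (\<Sum>i<m. L i)
      + real m * square_pyramid (- real m) - (\<Sum>i<m. square_pyramid (- real i - 1))"
    by (simp add: sum.distrib sum_subtractf sum_distrib_left P_def)
  finally have "(\<Sum>c\<in>hook_cells lam. (real (snd c))\<^sup>2) - (\<Sum>(i, j)\<in>diagram lam. (real j - real i)\<^sup>2)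
      = (\<Sum>i<m. L i)\<^sup>2 - ((real m)\<^sup>2 - real m) * (\<Sum>i<m. L i) + (real m)\<^sup>2 * (real m - 1)\<^sup>2 / 4"
    unfolding hooks sum_square_pyramid_negative by simp
  also have "\<dots> = n\<^sup>2"
    unfolding P1 by (simp add: power2_eq_square field_simps)
  finally show ?thesis by (simp add: n_def)
qed

section \<open>Partitions with positive parts\<close>

lemma is_partitionD:
  assumes "is_partition lam"
  shows "sorted_wrt (\<ge>) lam" "i < length lam \<Longrightarrow> 0 < lam ! i"
  using assms by (auto simp: is_partition_def)

lemma aft_eq:
  assumes "is_partition lam" "lam \<noteq> []"
  shows "aft lam = sum_list lam - max (lam ! 0) (length lam)"
proof -
  have pos: "0 < lam ! i" if "i < length lam" for i
    using is_partitionD(2)[OF assms(1) that] .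
  obtain p ps where "lam = p # ps" using assms(2) by (cases lam) auto
  then have f: "first_part lam = lam ! 0" by (simp add: first_part_def)
  have "{i. i < length lam \<and> 0 < lam ! i} = {..<length lam}" using pos by auto
  then have "Defs.conjugate lam \<noteq> []" and "Defs.conjugate lam ! 0 = length lam"
    using pos[of 0] assms(2) by (auto simp: Defs.conjugate_def f)
  then have "first_part (Defs.conjugate lam) = length lam"
    by (cases "Defs.conjugate lam") (auto simp: first_part_def)
  with f show ?thesis by (simp add: aft_def)
qed

text \<open>A shifted part counts its row and one cell of each later row, and these cells exist
  because the parts are positive.\<close>

lemma shifted_le_size:
  assumes "is_partition lam" "i < length lam"
  shows "shifted lam i \<le> sum_list lam"
proof -
  have "shifted lam i = lam ! i + (\<Sum>k\<in>{i<..<length lam}. 1)"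
    by (simp add: shifted_def)
  also have "\<dots> \<le> lam ! i + (\<Sum>k\<in>{i<..<length lam}. lam ! k)"
    using is_partitionD(2)[OF assms(1)] by (intro add_left_mono sum_mono) (simp add: Suc_le_eq)
  also have "\<dots> = (\<Sum>k\<in>insert i {i<..<length lam}. lam ! k)"
    by simp
  also have "\<dots> \<le> (\<Sum>k<length lam. lam ! k)"
    using assms(2) by (intro sum_mono2) auto
  finally show ?thesis by (simp add: sum_list_sum_nth atLeast0LessThan)
qed

section \<open>Cancellation along the longest line\<close>

text \<open>Here \<open>M\<close> is the length of the longest line of the diagram, \<open>a\<close> the number of remaining cells and
  \<open>S\<close> the sum of their squared contents, each of which is at most \<open>a\<close> and at most \<open>M - 1\<close> in
  absolute value. The first bound is the useful one if \<open>3 a \<le> n\<close>, the second one otherwise.\<close>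

lemma hook_variance_arith:
  fixes M a n S :: real
  assumes "a = 0 \<or> 1 \<le> a" "1 \<le> M" "n = M + a" "S \<le> a * a\<^sup>2" "S \<le> a * (M - 1)\<^sup>2"
  shows "a * n\<^sup>2 / 54 \<le> a * M\<^sup>2 + M * a * (a - 1) + a * (a - 1) * (2 * a - 1) / 6 - S"
proof -
  have a: "0 \<le> a" "0 \<le> a * (a - 1)" using assms(1) by auto
  have "0 \<le> M * a * (a - 1)" using a(2) assms(2) by (simp add: mult.assoc)
  moreover have "0 \<le> a * (a - 1) * (2 * a - 1)" using assms(1) by auto
  ultimately have pos: "0 \<le> M * a * (a - 1)" "0 \<le> a * (a - 1) * (2 * a - 1)" by auto
  show ?thesis
  proof (cases "3 * a \<le> n")
    \<comment> \<open>Here \<open>M\<close> is at least \<open>2 n / 3\<close> and \<open>a\<close>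
      at most \<open>n / 3\<close>, so the squares differ by at least a third of that of
      \<open>n\<close>, far more than required.\<close>
    case True
    have "(2 * n / 3)\<^sup>2 \<le> M\<^sup>2" using True assms a by (intro power_mono) auto
    moreover have "a\<^sup>2 \<le> (n / 3)\<^sup>2" using True a by (intro power_mono) auto
    moreover have "(2 * n / 3)\<^sup>2 = 4 * n\<^sup>2 / 9" "(n / 3)\<^sup>2 = n\<^sup>2 / 9"
      by (simp_all add: power_divide power_mult_distrib)
    ultimately have "n\<^sup>2 / 54 \<le> M\<^sup>2 - a\<^sup>2"
      using zero_le_power2[of n] by linarith
    then have "a * (n\<^sup>2 / 54) \<le> a * (M\<^sup>2 - a\<^sup>2)" using a by (intro mult_left_mono) auto
    then have "a * n\<^sup>2 / 54 \<le> a * M\<^sup>2 - a * a\<^sup>2" by (simp add: right_diff_distrib)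
    then show ?thesis using pos assms(4) by linarith
  next
    \<comment> \<open>This case dictates 54: from \<open>n < 3 a\<close>, a 54th of the square of
      \<open>n\<close> is at most a sixth of that of \<open>a\<close>.\<close>
    case False
    have "n\<^sup>2 \<le> (3 * a)\<^sup>2" using False assms a by (intro power_mono) auto
    then have "n\<^sup>2 / 54 \<le> a\<^sup>2 / 6" by (simp add: power_mult_distrib)
    moreover have "a\<^sup>2 / 6 \<le> 1 + (a - 1) * (2 * a - 1) / 6"
    proof -
      have "(a - 1) * (2 * a - 1) = 2 * a\<^sup>2 - 3 * a + 1"
        by (simp add: power2_eq_square algebra_simps)
      moreover have "(a - 3 / 2)\<^sup>2 = a\<^sup>2 - 3 * a + 9 / 4"
        by (simp add: power2_eq_square algebra_simps)
      ultimately show ?thesis using zero_le_power2[of "a - 3 / 2"] by linarith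
    qed
    moreover have "1 \<le> M\<^sup>2 - (M - 1)\<^sup>2" using assms(2) by (simp add: power2_eq_square algebra_simps)
    ultimately have "n\<^sup>2 / 54 \<le> M\<^sup>2 - (M - 1)\<^sup>2 + (a - 1) * (2 * a - 1) / 6" by simp
    then have "a * (n\<^sup>2 / 54) \<le> a * (M\<^sup>2 - (M - 1)\<^sup>2 + (a - 1) * (2 * a - 1) / 6)"
      using a by (intro mult_left_mono) auto
    then show ?thesis using pos assms(5) by (simp add: algebra_simps)
  qed
qed

text \<open>Trading hooks for contents makes the longest line contribute the squares of
  \<open>0, ..., M - 1\<close>, whether it is a row or a column; only the contents of the other
  cells need estimates. The constant is \<open>648 = 12 * 54\<close>.\<close>

lemma hook_variance_lower:
  assumes lam: "is_partition lam"
  shows "real (aft lam) * (real (sum_list lam))\<^sup>2 / 648 \<le> hook_variance lam"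
proof (cases "lam = []")
  case True
  then show ?thesis by (simp add: hook_variance_def hook_cells_def)
next
  case False
  define m where "m = length lam"
  define n where "n = sum_list lam"
  define M where "M = max (lam ! 0) m"
  define line where "line = (if m \<le> lam ! 0 then Pair 0 ` {..<lam ! 0} else (\<lambda>i. (i, 0)) ` {..<m})"
  define E where "E = diagram lam - line"
  have m: "0 < m" using False by (simp add: m_def)
  have pos: "0 < lam ! i" if "i < m" for i using is_partitionD(2)[OF lam] that by (simp add: m_def)
  have mono: "lam ! k \<le> lam ! i" if "i \<le> k" "k < m" for i k
    using is_partitionD(1)[OF lam] that
    by (cases "i = k") (auto simp: sorted_wrt_iff_nth_less m_def)
  have line: "line \<subseteq> diagram lam"
    using m pos by (auto simp: line_def diagram_def m_def)
  have card_line: "card line = M"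
    by (auto simp: line_def M_def card_image inj_on_def max_def)
  have sum_line: "(\<Sum>(i, j)\<in>line. (real j - real i)\<^sup>2) = (\<Sum>k<M. (real k)\<^sup>2)"
    by (auto simp: line_def M_def sum.reindex inj_on_def max_def split_def)
  have fin: "finite E" "finite line" using finite_diagram[of lam] finite_subset[OF line] by (auto simp: E_def)
  have Mn: "M \<le> n" using card_mono[OF finite_diagram line] card_line card_diagram[of lam] by (simp add: n_def)
  have a: "aft lam = n - M" using aft_eq[OF lam False] by (simp add: n_def M_def m_def)
  have card_E: "card E = aft lam"
    using card_Diff_subset[OF fin(2) line] card_line card_diagram[of lam] a by (simp add: E_def n_def)
  have sub: "card A \<le> aft lam" if "A \<subseteq> E" for A
    using card_mono[OF fin(1) that] card_E by simp
  have bounds: "i \<le> aft lam \<and> j \<le> aft lam \<and> i < M \<and> j < M" if "(i, j) \<in> E" for i j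
  proof -
    have ij: "i < m" "j < lam ! i" using that by (auto simp: E_def diagram_def m_def)
    have "i < M" "j < M"
      using ij mono[of 0 i] by (auto simp: M_def)
    moreover have "i \<le> aft lam \<and> j \<le> aft lam"
    proof (cases "m \<le> lam ! 0")
      \<comment> \<open>The first row is the line. Column 0 from row 1 down to \<open>i\<close> and
        row \<open>i\<close> up to column \<open>j\<close> avoid it, and counting these cells bounds
        \<open>i\<close> and \<open>j\<close>. The other case is the transpose.\<close>
      case True
      then have i: "0 < i" using that ij by (cases i) (auto simp: E_def line_def)
      have "(\<lambda>t. (t, 0::nat)) ` {1..i} \<subseteq> E"
        using True ij pos by (auto simp: E_def line_def diagram_def m_def)
      moreover have "Pair i ` {..j} \<subseteq> E"
        using True ij i by (auto simp: E_def line_def diagram_def m_def)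
      ultimately show ?thesis
        using sub[of "(\<lambda>t. (t, 0::nat)) ` {1..i}"] sub[of "Pair i ` {..j}"]
        by (simp add: card_image inj_on_def)
    next
      case False
      then have j: "0 < j" using that ij by (cases j) (auto simp: E_def line_def)
      have "Pair 0 ` {1..j} \<subseteq> E"
        using False ij mono[of 0 i] by (auto simp: E_def line_def diagram_def m_def)
      moreover have "(\<lambda>t. (t, j)) ` {..i} \<subseteq> E"
      proof clarify
        fix t assume "t \<le> i"
        then show "(t, j) \<in> E"
          using False ij j mono[of t i] by (auto simp: E_def line_def diagram_def m_def)
      qed
      ultimately show ?thesis
        using sub[of "Pair 0 ` {1..j}"] sub[of "(\<lambda>t. (t, j)) ` {..i}"]
        by (simp add: card_image inj_on_def)
    qed
    ultimately show ?thesis by simp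
  qed
  define S where "S = (\<Sum>(i, j)\<in>E. (real j - real i)\<^sup>2)"
  have "S \<le> real (card E) * (real (aft lam))\<^sup>2"
    unfolding S_def
  proof (rule sum_bounded_above)
    fix c assume "c \<in> E"
    then show "(case c of (i, j) \<Rightarrow> (real j - real i)\<^sup>2) \<le> (real (aft lam))\<^sup>2"
      using bounds[of "fst c" "snd c"] by (auto simp: split_def intro!: abs_le_square_iff[THEN iffD1])
  qed
  then have S1: "S \<le> real (aft lam) * (real (aft lam))\<^sup>2" by (simp add: card_E)
  have "S \<le> real (card E) * (real M - 1)\<^sup>2"
    unfolding S_def
  proof (rule sum_bounded_above)
    fix c assume "c \<in> E"
    then show "(case c of (i, j) \<Rightarrow> (real j - real i)\<^sup>2) \<le> (real M - 1)\<^sup>2"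
      using bounds[of "fst c" "snd c"] by (auto simp: split_def intro!: abs_le_square_iff[THEN iffD1])
  qed
  then have S2: "S \<le> real (aft lam) * (real M - 1)\<^sup>2" by (simp add: card_E)
  have "(\<Sum>(i, j)\<in>diagram lam. (real j - real i)\<^sup>2) = (\<Sum>k<M. (real k)\<^sup>2) + S"
    unfolding S_def E_def sum_line[symmetric]
    by (subst sum.subset_diff[OF line finite_diagram]) (rule add.commute)
  then have "12 * hook_variance lam
      = square_pyramid (real n) - ((real n)\<^sup>2 + (square_pyramid (real M) - (real M)\<^sup>2 + S))"
    using sum_hook_squares[OF is_partitionD(1)[OF lam]]
    unfolding hook_variance_def sum_squares by (simp add: sum_squares_lessThan n_def)
  also have "\<dots> = real (aft lam) * (real M)\<^sup>2 + real M * real (aft lam) * (real (aft lam) - 1)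
      + real (aft lam) * (real (aft lam) - 1) * (2 * real (aft lam) - 1) / 6 - S"
  proof -
    have n: "real n = real M + real (aft lam)" using a Mn by simp
    show ?thesis unfolding n square_pyramid_def by (simp add: power2_eq_square field_simps)
  qed
  also have "\<dots> \<ge> real (aft lam) * (real n)\<^sup>2 / 54"
    by (rule hook_variance_arith) (use S1 S2 a Mn m in \<open>auto simp: M_def\<close>)
  finally show ?thesis by (simp add: n_def)
qed

text \<open>The hooks of the longest line (first row or first column) are pairwise distinct elements of
  \<open>{1..n}\<close>, so they cancel against factors of the numerator of the hook formula and only
  \<open>aft lam\<close> factors survive above and below.\<close>

definition longest_line :: "nat list \<Rightarrow> (nat \<times> nat) set" where
  "longest_line lam = (if lam \<noteq> [] \<and> length lam \<le> lam ! 0 then Pair 0 ` hook_lengths lam 0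
     else (\<lambda>i. (i, shifted lam i)) ` {..<length lam})"

definition excess_entries :: "nat list \<Rightarrow> nat set" where
  "excess_entries lam = {1..sum_list lam} - snd ` longest_line lam"

definition excess_hooks :: "nat list \<Rightarrow> (nat \<times> nat) set" where
  "excess_hooks lam = hook_cells lam - longest_line lam"

definition min_maj :: "nat list \<Rightarrow> nat" where
  "min_maj lam = (\<Sum>i<length lam. i * lam ! i)"

lemma aft_le: "aft lam \<le> sum_list lam"
  by (simp add: aft_def)

lemma finite_hook_cells: "finite (hook_cells lam)"
  by (simp add: hook_cells_def finite_hooks)

lemma finite_excess: "finite (excess_entries lam)" "finite (excess_hooks lam)"
  by (auto simp: excess_entries_def excess_hooks_def finite_hook_cells)

context
  fixes lam :: "nat list"
  assumes lam: "is_partition lam"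
begin

lemma shifted_dec: "i < k \<Longrightarrow> k < length lam \<Longrightarrow> shifted lam k < shifted lam i"
  by (rule shifted_strict[OF is_partitionD(1)[OF lam]])

lemma hook_cells_range: "snd ` hook_cells lam \<subseteq> {1..sum_list lam}"
  using shifted_le_size[OF lam] by (fastforce simp: hook_cells_def hooks_def)

lemma longest_line_subset: "longest_line lam \<subseteq> hook_cells lam"
proof -
  have pos: "0 < shifted lam k" if "k < length lam" for k
    using is_partitionD(2)[OF lam that] by (simp add: shifted_def)
  have "shifted lam i \<in> hook_lengths lam i" if i: "i < length lam" for i
  proof -
    \<comment> \<open>Shifted parts are positive, so every gap is strictly below
      \<open>shifted lam i\<close>.\<close>
    have "shifted lam i \<noteq> shifted lam i - shifted lam k" if "k \<in> {i<..<length lam}" for k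
      using pos[of k] pos[OF i] that by simp
    then have "shifted lam i \<notin> (\<lambda>k. shifted lam i - shifted lam k) ` {i<..<length lam}"
      by blast
    then show ?thesis using pos[OF i] by (simp add: hooks_def Suc_le_eq)
  qed
  then show ?thesis by (auto simp: longest_line_def hook_cells_def)
qed

lemma inj_on_longest_line: "inj_on snd (longest_line lam)"
proof -
  have "shifted lam i \<noteq> shifted lam k" if "i < length lam" "k < length lam" "i \<noteq> k" for i k
    using shifted_dec[of i k] shifted_dec[of k i] that by (cases i k rule: linorder_cases) auto
  then show ?thesis by (auto simp: longest_line_def inj_on_def)
qed

lemma card_hook_cells: "card (hook_cells lam) = sum_list lam"
proof -
  have "card (hook_lengths lam i) = lam ! i" if "i < length lam" for i
    using card_hooks[of "length lam" "shifted lam" i] shifted_dec by (simp add: shifted_def)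
  then show ?thesis
    by (simp add: hook_cells_def finite_hooks sum_list_sum_nth atLeast0LessThan)
qed

lemma card_longest_line: "card (longest_line lam) = sum_list lam - aft lam"
proof (cases "lam = []")
  case False
  have "card (hook_lengths lam 0) = lam ! 0"
    using card_hooks[of "length lam" "shifted lam" 0] shifted_dec by (simp add: shifted_def)
  then have "card (longest_line lam) = max (lam ! 0) (length lam)"
    using False by (auto simp: longest_line_def card_image inj_on_def)
  moreover have "card (longest_line lam) \<le> sum_list lam"
    using card_mono[OF finite_hook_cells longest_line_subset] card_hook_cells by simp
  ultimately show ?thesis using aft_eq[OF lam False] by simp
qed (simp add: longest_line_def)

lemma finite_longest_line: "finite (longest_line lam)"
  using finite_subset[OF longest_line_subset finite_hook_cells] .

lemma longest_line_range: "snd ` longest_line lam \<subseteq> {1..sum_list lam}"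
  using longest_line_subset hook_cells_range by blast

lemma card_excess_entries: "card (excess_entries lam) = aft lam"
  unfolding excess_entries_def using longest_line_range finite_longest_line aft_le[of lam]
  by (subst card_Diff_subset) (auto simp: card_image inj_on_longest_line card_longest_line)

lemma card_excess_hooks: "card (excess_hooks lam) = aft lam"
  unfolding excess_hooks_def using longest_line_subset finite_longest_line aft_le[of lam]
  by (subst card_Diff_subset) (auto simp: card_hook_cells card_longest_line)

lemma excess_range: "excess_entries lam \<subseteq> {1..sum_list lam}" "snd ` excess_hooks lam \<subseteq> {1..sum_list lam}"
  using hook_cells_range by (auto simp: excess_entries_def excess_hooks_def)

lemma prod_entries: "(\<Prod>j=1..sum_list lam. f j) = (\<Prod>j\<in>excess_entries lam. f j) * (\<Prod>c\<in>longest_line lam. f (snd c) :: 'a::comm_monoid_mult)"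
proof -
  have "(\<Prod>j=1..sum_list lam. f j) = (\<Prod>j\<in>excess_entries lam. f j) * (\<Prod>j\<in>snd ` longest_line lam. f j)"
    unfolding excess_entries_def by (rule prod.subset_diff[OF longest_line_range]) simp
  then show ?thesis by (simp add: prod.reindex inj_on_longest_line)
qed

lemma prod_hook_cells: "(\<Prod>c\<in>hook_cells lam. f c) = (\<Prod>c\<in>excess_hooks lam. f c) * (\<Prod>c\<in>longest_line lam. f c :: 'a::comm_monoid_mult)"
  unfolding excess_hooks_def by (rule prod.subset_diff[OF longest_line_subset finite_hook_cells])

lemma sum_excess:
  fixes f :: "nat \<Rightarrow> 'a::ab_group_add"
  shows "(\<Sum>j=1..sum_list lam. f j) - (\<Sum>c\<in>hook_cells lam. f (snd c))
    = (\<Sum>j\<in>excess_entries lam. f j) - (\<Sum>c\<in>excess_hooks lam. f (snd c))"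
proof -
  have "(\<Sum>j=1..sum_list lam. f j) = (\<Sum>j\<in>excess_entries lam. f j) + (\<Sum>j\<in>snd ` longest_line lam. f j)"
    unfolding excess_entries_def by (rule sum.subset_diff[OF longest_line_range]) simp
  moreover have "(\<Sum>c\<in>hook_cells lam. f (snd c)) = (\<Sum>c\<in>excess_hooks lam. f (snd c)) + (\<Sum>c\<in>longest_line lam. f (snd c))"
    unfolding excess_hooks_def by (rule sum.subset_diff[OF longest_line_subset finite_hook_cells])
  ultimately show ?thesis by (simp add: sum.reindex inj_on_longest_line)
qed

lemma maj_gf_excess:
  fixes q :: "'a::field"
  assumes q: "\<And>k. 0 < k \<Longrightarrow> k \<le> sum_list lam \<Longrightarrow> q ^ k \<noteq> 1" "q \<noteq> 0"
  shows "maj_gf q lam = q ^ min_maj lam * (\<Prod>j\<in>excess_entries lam. 1 - q ^ j) / (\<Prod>c\<in>excess_hooks lam. 1 - q ^ snd c)"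
proof -
  have "maj_gf q lam = q ^ min_maj lam * qfac q (sum_list lam) / (\<Prod>i<length lam. \<Prod>h\<in>hook_lengths lam i. 1 - q ^ h)"
    unfolding min_maj_def
    by (rule maj_gf_hook_formula[OF is_partitionD(1)[OF lam] shifted_le_size[OF lam] order_refl q])
  also have "(\<Prod>i<length lam. \<Prod>h\<in>hook_lengths lam i. 1 - q ^ h) = (\<Prod>c\<in>hook_cells lam. 1 - q ^ snd c)"
    unfolding hook_cells_def by (subst prod.Sigma) (auto simp: finite_hooks split_def)
  also have "\<dots> = (\<Prod>c\<in>excess_hooks lam. 1 - q ^ snd c) * (\<Prod>c\<in>longest_line lam. 1 - q ^ snd c)"
    by (rule prod_hook_cells)
  finally have eq: "maj_gf q lam = q ^ min_maj lam * ((\<Prod>j\<in>excess_entries lam. 1 - q ^ j) * (\<Prod>c\<in>longest_line lam. 1 - q ^ snd c))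
      / ((\<Prod>c\<in>excess_hooks lam. 1 - q ^ snd c) * (\<Prod>c\<in>longest_line lam. 1 - q ^ snd c))"
    unfolding qfac_def prod_entries .
  have "1 - q ^ snd c \<noteq> 0" if "c \<in> longest_line lam" for c
    using q(1)[of "snd c"] longest_line_range that by fastforce
  then have "(\<Prod>c\<in>longest_line lam. 1 - q ^ snd c) \<noteq> 0"
    using finite_longest_line by simp
  with eq show ?thesis by (simp add: mult.assoc[symmetric])
qed

end

section \<open>The characteristic function\<close>

text \<open>With \<open>u = sin x / x - 1\<close>, Taylor's formula gives \<open>u\<close> up to
  \<open>x ^ 4 / 120\<close>. The logarithm adds at most twice the square of \<open>u\<close>, hence
  at most \<open>x ^ 4 / 2\<close>.\<close>

lemma ln_sin_div_bound:
  fixes x :: real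
  assumes "x \<noteq> 0" "\<bar>x\<bar> \<le> 1"
  shows "0 < sin x / x" "\<bar>ln (sin x / x) + x\<^sup>2 / 6\<bar> \<le> x ^ 4"
proof -
  define u where "u = sin x / x - 1"
  have "\<bar>sin x - (\<Sum>m<5. sin_coeff m * x ^ m)\<bar> \<le> inverse (fact 5) * \<bar>x\<bar> ^ 5"
    by (rule Maclaurin_sin_bound)
  also have "(\<Sum>m<5. sin_coeff m * x ^ m) = x - x ^ 3 / 6"
    by (simp add: sin_coeff_def lessThan_nat_numeral lessThan_Suc fact_numeral)
  finally have "\<bar>sin x - (x - x ^ 3 / 6)\<bar> / \<bar>x\<bar> \<le> inverse (fact 5) * \<bar>x\<bar> ^ 5 / \<bar>x\<bar>"
    by (intro divide_right_mono) auto
  also have "\<bar>sin x - (x - x ^ 3 / 6)\<bar> / \<bar>x\<bar> = \<bar>u + x\<^sup>2 / 6\<bar>"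
    unfolding abs_divide[symmetric] u_def using assms(1)
    by (intro arg_cong[where f = abs]) (simp add: field_simps power2_eq_square power3_eq_cube)
  also have "inverse (fact 5) * \<bar>x\<bar> ^ 5 / \<bar>x\<bar> = x ^ 4 / 120"
    using assms(1) by (simp add: fact_numeral eval_nat_numeral power_abs)
  finally have u1: "\<bar>u + x\<^sup>2 / 6\<bar> \<le> x ^ 4 / 120" .
  have x2: "0 \<le> x\<^sup>2" "x\<^sup>2 \<le> 1" using assms(2) by (auto simp: abs_square_le_1)
  have x4: "x ^ 4 = x\<^sup>2 * x\<^sup>2" by (simp add: eval_nat_numeral)
  have x42: "x ^ 4 \<le> x\<^sup>2" "0 \<le> x ^ 4"
    unfolding x4 using x2 by (blast intro: mult_left_le mult_nonneg_nonneg)+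
  have u2: "\<bar>u\<bar> \<le> x\<^sup>2 / 2" using u1 x42 by linarith
  then have "\<bar>u\<bar> \<le> 1 / 2" using x2 by linarith
  then have "\<bar>ln (1 + u) - u\<bar> \<le> 2 * u\<^sup>2" by (rule abs_ln_one_plus_x_minus_x_bound)
  moreover have "u\<^sup>2 \<le> x ^ 4 / 4"
  proof -
    have "\<bar>u\<bar>\<^sup>2 \<le> (x\<^sup>2 / 2)\<^sup>2" by (rule power_mono[OF u2]) simp
    then show ?thesis by (simp add: power_divide)
  qed
  ultimately have "\<bar>ln (1 + u) + x\<^sup>2 / 6\<bar> \<le> x ^ 4" using u1 x42 by linarith
  then show "\<bar>ln (sin x / x) + x\<^sup>2 / 6\<bar> \<le> x ^ 4" by (simp add: u_def)
  have "0 < 1 + u" using \<open>\<bar>u\<bar> \<le> 1 / 2\<close> by linarith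
  then show "0 < sin x / x" by (simp add: u_def)
qed

lemma one_minus_cis: "1 - cis x = - 2 * \<i> * complex_of_real (sin (x / 2)) * cis (x / 2)"
proof -
  have "sin x = 2 * sin (x / 2) * cos (x / 2)" "cos x = 1 - 2 * (sin (x / 2))\<^sup>2"
    using sin_double[of "x / 2"] cos_double_sin[of "x / 2"] by simp_all
  then show ?thesis
    by (simp add: complex_eq_iff power2_eq_square)
qed

lemma cis_neq_1: "0 < x \<Longrightarrow> x < 2 * pi \<Longrightarrow> cis x \<noteq> 1"
  using one_minus_cis[of x] sin_gt_zero[of "x / 2"] by auto

text \<open>Pulling the half angle out of \<open>1 - cis t ^ k\<close> leaves the phase
  \<open>k * t / 2\<close>; \<open>t * mean_maj lam\<close> is the total phase. That this is the
  expectation follows in \<open>expectation_maj\<close>.\<close>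

definition mean_maj :: "nat list \<Rightarrow> real" where
  "mean_maj lam = real (min_maj lam) + ((\<Sum>j\<in>excess_entries lam. real j) - (\<Sum>c\<in>excess_hooks lam. real (snd c))) / 2"

text \<open>A real logarithm is legitimate for \<open>0 < t\<close> and
  \<open>n * t \<le> 2\<close>: all half angles are then in \<open>(0, 1]\<close>, where
  \<open>sin x / x\<close> is positive.\<close>

definition log_char :: "nat list \<Rightarrow> real \<Rightarrow> real" where
  "log_char lam t = (\<Sum>j\<in>excess_entries lam. ln (sin (real j * t / 2) / (real j * t / 2)))
    - (\<Sum>c\<in>excess_hooks lam. ln (sin (real (snd c) * t / 2) / (real (snd c) * t / 2)))"

lemma half_angle:
  fixes n k :: nat and t :: real
  assumes "0 < t" "real n * t \<le> 2" "0 < k \<and> k \<le> n"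
  shows "real k * t / 2 \<noteq> 0" "\<bar>real k * t / 2\<bar> \<le> 1" "\<bar>real k * t / 2\<bar> \<le> real n * t / 2"
proof -
  have kt: "0 < real k * t" "real k * t \<le> real n * t"
    using assms by (auto intro!: mult_right_mono)
  show "real k * t / 2 \<noteq> 0" using assms by simp
  show "\<bar>real k * t / 2\<bar> \<le> 1" "\<bar>real k * t / 2\<bar> \<le> real n * t / 2"
    using kt assms(2) by simp_all
qed

context
  fixes lam :: "nat list" and n a :: nat
  assumes lam: "is_partition lam"
  defines "n \<equiv> sum_list lam" and "a \<equiv> aft lam"
begin

lemma excess_entry: "j \<in> excess_entries lam \<Longrightarrow> 0 < j \<and> j \<le> n"
  using excess_range(1)[OF lam] by (auto simp: n_def)

lemma excess_hook: "c \<in> excess_hooks lam \<Longrightarrow> 0 < snd c \<and> snd c \<le> n"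
  using excess_range(2)[OF lam] by (fastforce simp: n_def)

text \<open>The quadratic terms of the factors add up to the variance term exactly; what remains are
  \<open>2 a\<close> remainders, each at most \<open>(n t / 2) ^ 4\<close>.\<close>

lemma log_char_bound:
  assumes t: "0 < t" "real n * t \<le> 2"
  shows "\<bar>log_char lam t + hook_variance lam * t\<^sup>2 / 2\<bar> \<le> 2 * real a * (real n * t / 2) ^ 4"
proof -
  define r where "r k = ln (sin (real k * t / 2) / (real k * t / 2)) + (real k * t / 2)\<^sup>2 / 6" for k
  have r: "\<bar>r k\<bar> \<le> (real n * t / 2) ^ 4" if "0 < k \<and> k \<le> n" for k
  proof -
    have "\<bar>r k\<bar> \<le> (real k * t / 2) ^ 4"
      unfolding r_def using half_angle[OF t that] by (intro ln_sin_div_bound(2))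
    also have "\<dots> \<le> (real n * t / 2) ^ 4"
      using half_angle(3)[OF t that] t by (intro power_mono) auto
    finally show ?thesis .
  qed
  have "12 * hook_variance lam = (\<Sum>j\<in>excess_entries lam. (real j)\<^sup>2) - (\<Sum>c\<in>excess_hooks lam. (real (snd c))\<^sup>2)"
    unfolding hook_variance_def using sum_excess[OF lam, of "\<lambda>j. (real j)\<^sup>2"] by simp
  then have "log_char lam t + hook_variance lam * t\<^sup>2 / 2 = log_char lam t
      + ((\<Sum>j\<in>excess_entries lam. (real j)\<^sup>2) - (\<Sum>c\<in>excess_hooks lam. (real (snd c))\<^sup>2)) * t\<^sup>2 / 24"
    by simp
  also have "\<dots> = (\<Sum>j\<in>excess_entries lam. r j) - (\<Sum>c\<in>excess_hooks lam. r (snd c))"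
    by (simp add: log_char_def r_def sum.distrib sum_divide_distrib[symmetric] sum_distrib_right[symmetric]
        power_mult_distrib power_divide left_diff_distrib diff_divide_distrib)
  finally have "\<bar>log_char lam t + hook_variance lam * t\<^sup>2 / 2\<bar>
      \<le> \<bar>\<Sum>j\<in>excess_entries lam. r j\<bar> + \<bar>\<Sum>c\<in>excess_hooks lam. r (snd c)\<bar>"
    by linarith
  also have "\<dots> \<le> (\<Sum>j\<in>excess_entries lam. \<bar>r j\<bar>) + (\<Sum>c\<in>excess_hooks lam. \<bar>r (snd c)\<bar>)"
    by (intro add_mono sum_abs)
  also have "\<dots> \<le> real (card (excess_entries lam)) * (real n * t / 2) ^ 4
      + real (card (excess_hooks lam)) * (real n * t / 2) ^ 4"
    using r excess_entry excess_hook by (intro add_mono sum_bounded_above) auto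
  finally show ?thesis
    by (simp add: card_excess_entries[OF lam] card_excess_hooks[OF lam] a_def)
qed

text \<open>Numerator and denominator have equally many factors, so the powers of
  \<open>-2 * \<i>\<close> and of \<open>t / 2\<close> cancel. The quotient of the entries by the
  hooks stays as a constant to be identified later.\<close>

lemma char_sum_aux:
  assumes t: "0 < t" "real n * t \<le> 2"
  shows "(\<Sum>T\<in>SYT lam. cis (t * (real (maj lam T) - mean_maj lam)))
    = of_real ((\<Prod>j\<in>excess_entries lam. real j) / (\<Prod>c\<in>excess_hooks lam. real (snd c)) * exp (log_char lam t))"
proof -
  let ?J = "excess_entries lam" and ?K = "excess_hooks lam"
  let ?s = "\<lambda>k. sin (real k * t / 2)"
  let ?x = "\<lambda>k. real k * t / 2"
  have small: "0 < real k * t \<and> real k * t < 2 * pi" if "0 < k \<and> k \<le> n" for k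
  proof -
    have "0 < real k * t" "real k * t \<le> real n * t"
      using that t by (auto intro!: mult_right_mono)
    then show ?thesis using t(2) pi_gt3 by linarith
  qed
  have gf: "maj_gf (cis t) lam = cis t ^ min_maj lam * (\<Prod>j\<in>?J. 1 - cis t ^ j) / (\<Prod>c\<in>?K. 1 - cis t ^ snd c)"
  proof (rule maj_gf_excess[OF lam])
    show "cis t ^ k \<noteq> 1" if "0 < k" "k \<le> sum_list lam" for k
      using cis_neq_1[of "real k * t"] small[of k] that by (auto simp: n_def Complex.DeMoivre)
  qed simp
  define w :: complex where "w = - 2 * \<i>"
  have w: "w \<noteq> 0" by (simp add: w_def)
  have factor: "1 - cis t ^ k = w * (of_real (?s k) * cis (?x k))" for k
    using one_minus_cis[of "real k * t"] unfolding Complex.DeMoivre w_def by (simp add: mult.assoc)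
  have prod_cis: "(\<Prod>j\<in>A. cis (f j)) = cis (\<Sum>j\<in>A. f j)" for A and f :: "'b \<Rightarrow> real"
    by (induction A rule: infinite_finite_induct) (auto simp: cis_mult)
  have num: "(\<Prod>j\<in>?J. 1 - cis t ^ j) = w ^ a * (of_real (\<Prod>j\<in>?J. ?s j) * cis (\<Sum>j\<in>?J. ?x j))"
    unfolding factor prod.distrib prod_cis
    by (simp add: card_excess_entries[OF lam] a_def)
  have den: "(\<Prod>c\<in>?K. 1 - cis t ^ snd c) = w ^ a * (of_real (\<Prod>c\<in>?K. ?s (snd c)) * cis (\<Sum>c\<in>?K. ?x (snd c)))"
    unfolding factor prod.distrib prod_cis
    by (simp add: card_excess_hooks[OF lam] a_def)
  have sum_x: "(\<Sum>j\<in>?J. ?x j) = t * (\<Sum>j\<in>?J. real j) / 2" "(\<Sum>c\<in>?K. ?x (snd c)) = t * (\<Sum>c\<in>?K. real (snd c)) / 2"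
    by (simp_all add: sum_divide_distrib[symmetric] sum_distrib_left mult.commute)
  have "maj_gf (cis t) lam = cis (t * mean_maj lam) * of_real ((\<Prod>j\<in>?J. ?s j) / (\<Prod>c\<in>?K. ?s (snd c)))"
  proof -
    have phase: "t * mean_maj lam = real (min_maj lam) * t + (\<Sum>j\<in>?J. ?x j) - (\<Sum>c\<in>?K. ?x (snd c))"
      unfolding mean_maj_def sum_x by (simp add: field_simps)
    have "maj_gf (cis t) lam = cis (real (min_maj lam) * t) * (of_real (\<Prod>j\<in>?J. ?s j) * cis (\<Sum>j\<in>?J. ?x j))
        / (of_real (\<Prod>c\<in>?K. ?s (snd c)) * cis (\<Sum>c\<in>?K. ?x (snd c)))"
      unfolding gf num den using w by (simp add: Complex.DeMoivre)
    also have "\<dots> = (cis (real (min_maj lam) * t) * cis (\<Sum>j\<in>?J. ?x j) / cis (\<Sum>c\<in>?K. ?x (snd c)))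
        * of_real ((\<Prod>j\<in>?J. ?s j) / (\<Prod>c\<in>?K. ?s (snd c)))"
      by (simp add: mult_ac)
    finally show ?thesis unfolding phase cis_mult cis_divide .
  qed
  moreover have "(\<Sum>T\<in>SYT lam. cis (t * (real (maj lam T) - mean_maj lam))) = maj_gf (cis t) lam * cis (- t * mean_maj lam)"
    unfolding maj_gf_def sum_distrib_right
    by (intro sum.cong refl) (simp add: Complex.DeMoivre cis_mult right_diff_distrib mult.commute)
  ultimately have "(\<Sum>T\<in>SYT lam. cis (t * (real (maj lam T) - mean_maj lam)))
      = of_real ((\<Prod>j\<in>?J. ?s j) / (\<Prod>c\<in>?K. ?s (snd c))) * (cis (t * mean_maj lam) * cis (- t * mean_maj lam))"
    by (simp only: mult_ac)
  then have sum: "(\<Sum>T\<in>SYT lam. cis (t * (real (maj lam T) - mean_maj lam)))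
      = of_real ((\<Prod>j\<in>?J. ?s j) / (\<Prod>c\<in>?K. ?s (snd c)))"
    by (simp add: cis_mult)
  have split: "?s k = real k * (t / 2) * exp (ln (?s k / ?x k))" if "0 < k \<and> k \<le> n" for k
    using half_angle[OF t that] ln_sin_div_bound(1)[of "?x k"] by simp
  have "(\<Prod>j\<in>?J. ?s j) = (\<Prod>j\<in>?J. real j * (t / 2) * exp (ln (?s j / ?x j)))"
    using split excess_entry by (intro prod.cong) auto
  also have "\<dots> = (t / 2) ^ a * ((\<Prod>j\<in>?J. real j) * exp (\<Sum>j\<in>?J. ln (?s j / ?x j)))"
    unfolding prod.distrib by (simp add: card_excess_entries[OF lam] a_def exp_sum finite_excess mult_ac)
  finally have J: "(\<Prod>j\<in>?J. ?s j) = (t / 2) ^ a * ((\<Prod>j\<in>?J. real j) * exp (\<Sum>j\<in>?J. ln (?s j / ?x j)))" .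
  have "(\<Prod>c\<in>?K. ?s (snd c)) = (\<Prod>c\<in>?K. real (snd c) * (t / 2) * exp (ln (?s (snd c) / ?x (snd c))))"
    using split excess_hook by (intro prod.cong) auto
  also have "\<dots> = (t / 2) ^ a * ((\<Prod>c\<in>?K. real (snd c)) * exp (\<Sum>c\<in>?K. ln (?s (snd c) / ?x (snd c))))"
    unfolding prod.distrib by (simp add: card_excess_hooks[OF lam] a_def exp_sum finite_excess mult_ac)
  finally have K: "(\<Prod>c\<in>?K. ?s (snd c)) = (t / 2) ^ a * ((\<Prod>c\<in>?K. real (snd c)) * exp (\<Sum>c\<in>?K. ln (?s (snd c) / ?x (snd c))))" .
  have "(\<Prod>j\<in>?J. ?s j) / (\<Prod>c\<in>?K. ?s (snd c)) = (\<Prod>j\<in>?J. real j) / (\<Prod>c\<in>?K. real (snd c)) * exp (log_char lam t)"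
    unfolding J K log_char_def exp_diff using t by simp
  with sum show ?thesis by simp
qed

end

section \<open>Mean, variance and range of the major index\<close>

lemma tendsto_one_minus_cos_div_square:
  "((\<lambda>t. (1 - cos (t * y)) / t\<^sup>2) \<longlongrightarrow> y\<^sup>2 / 2) (at_right (0::real))"
proof (cases "y = 0")
  case False
  then have "((\<lambda>t. (1 - cos (t * y)) / t\<^sup>2) \<longlongrightarrow> y * y / 2) (at_right (0::real))"
    by real_asymp
  then show ?thesis by (simp add: power2_eq_square)
qed simp

lemma tendsto_sin_div:
  "((\<lambda>t. sin (t * y) / t) \<longlongrightarrow> y) (at_right (0::real))"
proof (cases "y = 0")
  case False
  then show ?thesis by real_asymp
qed simp

lemma eventually_small:
  fixes n :: nat
  shows "\<forall>\<^sub>F t in at_right (0::real). 0 < t \<and> real n * t \<le> 2"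
proof -
  have "\<forall>\<^sub>F t in at_right (0::real). t \<in> {0<..<2 / (real n + 1)}"
    by (rule eventually_at_right_real) simp
  then show ?thesis
  proof eventually_elim
    case (elim t)
    then have "(real n + 1) * t < 2" by (simp add: field_simps)
    moreover have "(real n + 1) * t = real n * t + t" by (simp add: algebra_simps)
    ultimately show ?case using elim by auto
  qed
qed

context
  fixes lam :: "nat list" and n a :: nat
  assumes lam: "is_partition lam"
  defines "n \<equiv> sum_list lam" and "a \<equiv> aft lam"
begin

lemma log_char_tendsto: "((\<lambda>t. log_char lam t / t\<^sup>2) \<longlongrightarrow> - hook_variance lam / 2) (at_right 0)"
proof -
  define C where "C = 2 * real a * (real n / 2) ^ 4"
  have "((\<lambda>t. log_char lam t / t\<^sup>2 + hook_variance lam / 2) \<longlongrightarrow> 0) (at_right 0)"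
  proof (rule Lim_null_comparison)
    show "\<forall>\<^sub>F t in at_right 0. norm (log_char lam t / t\<^sup>2 + hook_variance lam / 2) \<le> C * t\<^sup>2"
      using eventually_small[of n]
    proof eventually_elim
      case (elim t)
      have "\<bar>log_char lam t + hook_variance lam * t\<^sup>2 / 2\<bar> \<le> C * t ^ 4"
        using log_char_bound[OF lam, of t] elim
        by (simp add: n_def a_def C_def power_mult_distrib power_divide mult_ac)
      then have "\<bar>log_char lam t + hook_variance lam * t\<^sup>2 / 2\<bar> / t\<^sup>2 \<le> C * t ^ 4 / t\<^sup>2"
        by (rule divide_right_mono) simp
      moreover have "\<bar>log_char lam t + hook_variance lam * t\<^sup>2 / 2\<bar> / t\<^sup>2
          = \<bar>log_char lam t / t\<^sup>2 + hook_variance lam / 2\<bar>"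
      proof -
        have "log_char lam t / t\<^sup>2 + hook_variance lam / 2 = (log_char lam t + hook_variance lam * t\<^sup>2 / 2) / t\<^sup>2"
          using elim by (simp add: field_simps)
        then show ?thesis by simp
      qed
      moreover have "t ^ 4 / t\<^sup>2 = t\<^sup>2"
        using elim by (simp add: field_simps eval_nat_numeral)
      moreover have "C * t ^ 4 / t\<^sup>2 = C * (t ^ 4 / t\<^sup>2)" by simp
      ultimately show ?case by (simp only: real_norm_def)
    qed
    show "((\<lambda>t. C * t\<^sup>2) \<longlongrightarrow> 0) (at_right 0)" by (auto intro!: tendsto_eq_intros)
  qed
  from tendsto_diff[OF this tendsto_const[of "hook_variance lam / 2"]] show ?thesis by simp
qed

lemma log_char_tendsto_0: "((\<lambda>t. log_char lam t) \<longlongrightarrow> 0) (at_right 0)"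
proof -
  have "((\<lambda>t. log_char lam t / t\<^sup>2 * t\<^sup>2) \<longlongrightarrow> - hook_variance lam / 2 * 0\<^sup>2) (at_right 0)"
    by (intro tendsto_intros log_char_tendsto)
  moreover have "\<forall>\<^sub>F t in at_right 0. log_char lam t / t\<^sup>2 * t\<^sup>2 = log_char lam t"
    using eventually_small[of n] by eventually_elim simp
  ultimately have "(log_char lam \<longlongrightarrow> - hook_variance lam / 2 * 0\<^sup>2) (at_right 0)"
    by (rule Lim_transform_eventually)
  then show ?thesis by simp
qed

text \<open>As \<open>t\<close> tends to 0, the real part tends to the number of tableaux on one
  side and to the unknown constant \<open>C\<close> on the other.\<close>

lemma char_sum:
  assumes t: "0 < t" "real n * t \<le> 2"
  shows "(\<Sum>T\<in>SYT lam. cis (t * (real (maj lam T) - mean_maj lam)))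
    = of_real (real (card (SYT lam)) * exp (log_char lam t))"
proof -
  define C where "C = (\<Prod>j\<in>excess_entries lam. real j) / (\<Prod>c\<in>excess_hooks lam. real (snd c))"
  have aux: "(\<Sum>T\<in>SYT lam. cis (t * (real (maj lam T) - mean_maj lam))) = of_real (C * exp (log_char lam t))"
    if "0 < t" "real n * t \<le> 2" for t
    using char_sum_aux[OF lam, of t] that by (simp add: n_def C_def)
  have "((\<lambda>t. \<Sum>T\<in>SYT lam. cos (t * (real (maj lam T) - mean_maj lam)))
      \<longlongrightarrow> (\<Sum>T\<in>SYT lam. cos (0 * (real (maj lam T) - mean_maj lam)))) (at_right 0)"
    by (intro tendsto_intros)
  then have "((\<lambda>t. \<Sum>T\<in>SYT lam. cos (t * (real (maj lam T) - mean_maj lam))) \<longlongrightarrow> real (card (SYT lam))) (at_right 0)"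
    by simp
  moreover have "\<forall>\<^sub>F t in at_right 0. (\<Sum>T\<in>SYT lam. cos (t * (real (maj lam T) - mean_maj lam))) = C * exp (log_char lam t)"
    using eventually_small[of n]
  proof eventually_elim
    case (elim t)
    then show ?case using arg_cong[OF aux[of t], of Re] by simp
  qed
  ultimately have "((\<lambda>t. C * exp (log_char lam t)) \<longlongrightarrow> real (card (SYT lam))) (at_right 0)"
    by (rule Lim_transform_eventually)
  moreover have "((\<lambda>t. C * exp (log_char lam t)) \<longlongrightarrow> C * exp 0) (at_right 0)"
    by (intro tendsto_intros log_char_tendsto_0)
  ultimately have "real (card (SYT lam)) = C * exp 0"
    by (rule tendsto_unique[OF trivial_limit_at_right_real])
  then have "C = real (card (SYT lam))" by simp
  then show ?thesis using aux[OF t] by simp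
qed

lemma card_SYT_pos: "0 < card (SYT lam)"
  using finite_SYT SYT_nonempty by (simp add: card_gt_0_iff)

text \<open>The centered sum is real for small \<open>t\<close>. Its imaginary part divided by
  \<open>t\<close> is thus 0 and tends to the sum of the deviations.\<close>

lemma sum_maj_centered: "(\<Sum>T\<in>SYT lam. real (maj lam T) - mean_maj lam) = 0"
proof -
  have "((\<lambda>t. \<Sum>T\<in>SYT lam. sin (t * (real (maj lam T) - mean_maj lam)) / t)
      \<longlongrightarrow> (\<Sum>T\<in>SYT lam. real (maj lam T) - mean_maj lam)) (at_right 0)"
    by (intro tendsto_sum tendsto_sin_div)
  moreover have "\<forall>\<^sub>F t in at_right 0. (\<Sum>T\<in>SYT lam. sin (t * (real (maj lam T) - mean_maj lam)) / t) = 0"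
    using eventually_small[of n]
  proof eventually_elim
    case (elim t)
    then show ?case using arg_cong[OF char_sum[of t], of Im] by (simp flip: sum_divide_distrib)
  qed
  ultimately have "((\<lambda>t. 0) \<longlongrightarrow> (\<Sum>T\<in>SYT lam. real (maj lam T) - mean_maj lam)) (at_right (0::real))"
    by (rule Lim_transform_eventually)
  then show ?thesis by (simp add: tendsto_const_iff)
qed

text \<open>Comparison of the second-order terms of the real parts at \<open>t = 0\<close>.\<close>

lemma sum_maj_centered_square:
  "(\<Sum>T\<in>SYT lam. (real (maj lam T) - mean_maj lam)\<^sup>2) = real (card (SYT lam)) * hook_variance lam"
proof -
  let ?N = "real (card (SYT lam))" and ?Y = "\<lambda>T. real (maj lam T) - mean_maj lam"
  have "((\<lambda>t. \<Sum>T\<in>SYT lam. (1 - cos (t * ?Y T)) / t\<^sup>2) \<longlongrightarrow> (\<Sum>T\<in>SYT lam. (?Y T)\<^sup>2 / 2)) (at_right 0)"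
    by (intro tendsto_sum tendsto_one_minus_cos_div_square)
  moreover have "\<forall>\<^sub>F t in at_right 0. (\<Sum>T\<in>SYT lam. (1 - cos (t * ?Y T)) / t\<^sup>2)
      = ?N * ((1 - exp (log_char lam t)) / t\<^sup>2)"
    using eventually_small[of n]
  proof eventually_elim
    case (elim t)
    then have "(\<Sum>T\<in>SYT lam. cos (t * ?Y T)) = ?N * exp (log_char lam t)"
      using arg_cong[OF char_sum[of t], of Re] by simp
    then have "(\<Sum>T\<in>SYT lam. 1 - cos (t * ?Y T)) = ?N * (1 - exp (log_char lam t))"
      by (simp add: sum_subtractf right_diff_distrib)
    then show ?case by (simp flip: sum_divide_distrib)
  qed
  ultimately have lim1: "((\<lambda>t. ?N * ((1 - exp (log_char lam t)) / t\<^sup>2)) \<longlongrightarrow> (\<Sum>T\<in>SYT lam. (?Y T)\<^sup>2 / 2)) (at_right 0)"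
    by (rule Lim_transform_eventually)
  \<comment> \<open>A continuous extension instead of division by \<open>log_char lam t\<close>,
    which may vanish, for instance identically if \<open>a = 0\<close>.\<close>
  define g where "g x = (if x = 0 then 1 else (exp x - 1) / x)" for x :: real
  have g: "exp x - 1 = x * g x" for x by (simp add: g_def)
  have "isCont g 0"
    unfolding isCont_def
  proof (rule Lim_transform_eventually)
    show "(\<lambda>x::real. (exp x - 1) / x) \<midarrow>0\<rightarrow> g 0"
      using DERIV_exp[of "0::real"] by (simp add: DERIV_def g_def)
    show "\<forall>\<^sub>F x in at 0. (exp x - 1) / x = g x"
      by (auto simp: eventually_at_filter g_def)
  qed
  then have "((\<lambda>t. g (log_char lam t)) \<longlongrightarrow> g 0) (at_right 0)"
    by (rule isCont_tendsto_compose[OF _ log_char_tendsto_0])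
  then have "((\<lambda>t. ?N * - (log_char lam t / t\<^sup>2 * g (log_char lam t))) \<longlongrightarrow> ?N * - (- hook_variance lam / 2 * g 0)) (at_right 0)"
    by (intro tendsto_intros log_char_tendsto)
  moreover have "(1 - exp (log_char lam t)) / t\<^sup>2 = - (log_char lam t / t\<^sup>2 * g (log_char lam t))" for t
    using g[of "log_char lam t"] by (simp add: field_simps)
  ultimately have "((\<lambda>t. ?N * ((1 - exp (log_char lam t)) / t\<^sup>2)) \<longlongrightarrow> ?N * hook_variance lam / 2) (at_right 0)"
    by (simp add: g_def)
  with lim1 have "(\<Sum>T\<in>SYT lam. (?Y T)\<^sup>2 / 2) = ?N * hook_variance lam / 2"
    by (rule tendsto_unique[OF trivial_limit_at_right_real])
  then show ?thesis by (simp flip: sum_divide_distrib)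
qed

text \<open>For \<open>q\<close> near \<open>0\<close> the generating function is of order \<open>q ^ min_maj lam\<close>, whereas each tableau
  contributes \<open>q ^ maj lam T\<close>.\<close>

lemma min_maj_le:
  assumes T: "T \<in> SYT lam"
  shows "min_maj lam \<le> maj lam T"
proof (rule ccontr)
  assume less: "\<not> min_maj lam \<le> maj lam T"
  \<comment> \<open>Every hook factor is at least \<open>1 / 2\<close>, so the quotient of the
    products is at most \<open>2 ^ a\<close>; this \<open>q\<close> makes
    \<open>q * 2 ^ a = 1 / 2\<close>.\<close>
  define q :: real where "q = (1 / 2) ^ Suc a"
  have q: "0 < q" "q \<le> 1 / 2"
    unfolding q_def by (auto simp: power_le_one)
  have pow: "q ^ k \<le> 1 / 2" if "0 < k" for k
  proof -
    have "q ^ k \<le> q ^ 1" using q that by (intro power_decreasing) auto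
    then show ?thesis using q by simp
  qed
  have gf: "maj_gf q lam = q ^ min_maj lam * (\<Prod>j\<in>excess_entries lam. 1 - q ^ j) / (\<Prod>c\<in>excess_hooks lam. 1 - q ^ snd c)"
  proof (rule maj_gf_excess[OF lam])
    show "q ^ k \<noteq> 1" if "0 < k" for k using pow[OF that] by linarith
  qed (use q in auto)
  have "(\<Prod>j\<in>excess_entries lam. 1 - q ^ j) \<le> 1"
    using q by (intro prod_le_1) (auto simp: power_le_one)
  moreover have "(1 / 2) ^ a \<le> (\<Prod>c\<in>excess_hooks lam. 1 - q ^ snd c)"
  proof -
    have "(\<Prod>c\<in>excess_hooks lam. 1 / 2) \<le> (\<Prod>c\<in>excess_hooks lam. 1 - q ^ snd c)"
    proof (intro prod_mono conjI)
      fix c assume "c \<in> excess_hooks lam"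
      then show "1 / 2 \<le> 1 - q ^ snd c"
        using pow[of "snd c"] excess_hook[OF lam] by fastforce
    qed simp
    then show ?thesis by (simp add: card_excess_hooks[OF lam] a_def)
  qed
  ultimately have "(\<Prod>j\<in>excess_entries lam. 1 - q ^ j) / (\<Prod>c\<in>excess_hooks lam. 1 - q ^ snd c) \<le> 1 / (1 / 2) ^ a"
    by (intro frac_le) auto
  then have "q ^ min_maj lam * ((\<Prod>j\<in>excess_entries lam. 1 - q ^ j) / (\<Prod>c\<in>excess_hooks lam. 1 - q ^ snd c))
      \<le> q ^ min_maj lam * (1 / (1 / 2) ^ a)"
    using q by (intro mult_left_mono) auto
  then have "maj_gf q lam \<le> q ^ min_maj lam * (1 / (1 / 2) ^ a)"
    unfolding gf by simp
  also have "\<dots> \<le> q ^ Suc (maj lam T) * (1 / (1 / 2) ^ a)"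
    using less q by (intro mult_right_mono power_decreasing) auto
  also have "\<dots> = q ^ maj lam T / 2"
    by (simp add: q_def)
  also have "\<dots> < q ^ maj lam T" using q by simp
  also have "\<dots> \<le> maj_gf q lam"
    unfolding maj_gf_def using q T finite_SYT by (intro member_le_sum) auto
  finally show False by simp
qed

lemma maj_lower: "T \<in> SYT lam \<Longrightarrow> - (real a * real n / 2) \<le> real (maj lam T) - mean_maj lam"
proof -
  assume "T \<in> SYT lam"
  then have "real (min_maj lam) \<le> real (maj lam T)" using min_maj_le by simp
  moreover have "(\<Sum>j\<in>excess_entries lam. real j) \<le> real (card (excess_entries lam)) * real n"
    using excess_entry[OF lam] by (intro sum_bounded_above) (auto simp: n_def)
  then have "(\<Sum>j\<in>excess_entries lam. real j) \<le> real a * real n"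
    by (simp add: card_excess_entries[OF lam] a_def)
  moreover have "0 \<le> (\<Sum>c\<in>excess_hooks lam. real (snd c))" by (intro sum_nonneg) simp
  ultimately show ?thesis unfolding mean_maj_def by (simp add: field_simps)
qed

end

section \<open>Standardization and limit\<close>

abbreviation SYT_measure :: "nat list \<Rightarrow> (nat \<times> nat \<Rightarrow> nat) measure" where
  "SYT_measure lam \<equiv> measure_pmf (pmf_of_set (SYT lam))"

abbreviation std_maj :: "nat list \<Rightarrow> (nat \<times> nat \<Rightarrow> nat) \<Rightarrow> real" where
  "std_maj lam \<equiv> standardize (SYT_measure lam) (\<lambda>T. real (maj lam T))"

lemma integral_SYT: "(\<integral>T. f T \<partial>SYT_measure lam) = (\<Sum>T\<in>SYT lam. f T) / real (card (SYT lam))"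
  for f :: "_ \<Rightarrow> real"
  by (rule integral_pmf_of_set[OF SYT_nonempty finite_SYT])

lemma complex_integral_SYT: "(\<integral>T. f T \<partial>SYT_measure lam) = (\<Sum>T\<in>SYT lam. f T) / of_nat (card (SYT lam))"
  for f :: "_ \<Rightarrow> complex"
  by (subst integral_measure_pmf[OF finite_SYT[of lam]])
    (auto simp: SYT_nonempty finite_SYT scaleR_conv_of_real sum_divide_distrib)

lemma expectation_maj:
  assumes "is_partition lam"
  shows "(\<integral>T. real (maj lam T) \<partial>SYT_measure lam) = mean_maj lam"
proof -
  have "(\<Sum>T\<in>SYT lam. real (maj lam T)) = real (card (SYT lam)) * mean_maj lam"
    using sum_maj_centered[OF assms] by (simp add: sum_subtractf)
  then show ?thesis using card_SYT_pos[OF assms] by (simp add: integral_SYT)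
qed

lemma variance_maj:
  assumes "is_partition lam"
  shows "(\<integral>T. (real (maj lam T) - mean_maj lam)\<^sup>2 \<partial>SYT_measure lam) = hook_variance lam"
  using card_SYT_pos[OF assms] by (simp add: integral_SYT sum_maj_centered_square[OF assms])

lemma std_maj_eq:
  assumes "is_partition lam"
  shows "std_maj lam T = (if hook_variance lam = 0 then 0 else (real (maj lam T) - mean_maj lam) / sqrt (hook_variance lam))"
  by (simp add: standardize_def expectation_maj[OF assms] variance_maj[OF assms])

text \<open>The squared deviation is at most \<open>162 = 648 / 4\<close> times \<open>a\<close>
  times the variance, and 162 is rounded up to \<open>169 = 13 * 13\<close>. The size
  \<open>n\<close> drops out.\<close>

lemma std_maj_lower:
  assumes lam: "is_partition lam" and T: "T \<in> SYT lam"
  shows "- (13 * sqrt (real (aft lam))) \<le> std_maj lam T"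
proof (cases "hook_variance lam = 0")
  case True
  then show ?thesis by (simp add: std_maj_eq[OF lam])
next
  case False
  let ?n = "real (sum_list lam)" and ?a = "real (aft lam)" and ?s = "sqrt (hook_variance lam)"
  have "0 \<le> ?a * ?n\<^sup>2 / 648" by simp
  then have "0 < hook_variance lam" using hook_variance_lower[OF lam] False by linarith
  then have s: "0 < ?s" by simp
  have "(?a * ?n / 2)\<^sup>2 = 162 * ?a * (?a * ?n\<^sup>2 / 648)"
    by (simp add: power2_eq_square)
  also have "\<dots> \<le> 169 * ?a * hook_variance lam"
    using hook_variance_lower[OF lam] by (intro mult_mono) auto
  also have "\<dots> = (13 * sqrt ?a * ?s)\<^sup>2"
    using s by (simp add: power_mult_distrib)
  finally have "?a * ?n / 2 \<le> 13 * sqrt ?a * ?s"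
    by (rule power2_le_imp_le) (use s in simp)
  then have "- (13 * sqrt ?a * ?s) \<le> real (maj lam T) - mean_maj lam"
    using maj_lower[OF lam T] by simp
  then show ?thesis
    using s False by (simp add: std_maj_eq[OF lam] field_simps)
qed

lemma char_std_maj:
  assumes lam: "is_partition lam" and V: "0 < hook_variance lam"
    and s: "0 < s" "real (sum_list lam) * (s / sqrt (hook_variance lam)) \<le> 2"
  shows "(CLINT T|SYT_measure lam. iexp (s * std_maj lam T)) = of_real (exp (log_char lam (s / sqrt (hook_variance lam))))"
proof -
  let ?t = "s / sqrt (hook_variance lam)"
  have "(CLINT T|SYT_measure lam. iexp (s * std_maj lam T))
      = (\<Sum>T\<in>SYT lam. cis (?t * (real (maj lam T) - mean_maj lam))) / of_nat (card (SYT lam))"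
    unfolding complex_integral_SYT using V by (simp add: std_maj_eq[OF lam] cis_conv_exp)
  also have "\<dots> = of_real (real (card (SYT lam)) * exp (log_char lam ?t)) / of_nat (card (SYT lam))"
    using V s by (subst char_sum[OF lam]) auto
  also have "\<dots> = of_real (exp (log_char lam ?t))"
    using card_SYT_pos[OF lam] by simp
  finally show ?thesis .
qed

text \<open>The density is positive everywhere, so a half-line of probability 0 would be a Lebesgue
  null set, although it contains a unit interval.\<close>

lemma std_normal_atMost_pos: "0 < measure std_normal_distribution {..x::real}"
proof -
  interpret prob_space std_normal_distribution
    by (rule prob_space_normal_density) simp
  have "\<not> emeasure std_normal_distribution {..x} = 0"
  proof
    assume "emeasure std_normal_distribution {..x} = 0"
    then have "AE y in lborel. y \<in> {..x} \<longrightarrow> ennreal (std_normal_density y) = 0"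
      by (subst (asm) emeasure_density) (auto simp: nn_integral_0_iff_AE indicator_def elim!: eventually_mono split: if_splits)
    then have "AE y in lborel. y \<notin> {..x}"
      by (elim eventually_mono) (auto simp: std_normal_density_def)
    then have "emeasure lborel {..x} = 0"
      by (subst (asm) AE_iff_measurable[OF _ refl]) (auto simp: atMost_def)
    moreover have "emeasure lborel {x - 1..x} \<le> emeasure lborel {..x}"
      by (intro emeasure_mono) auto
    ultimately show False by simp
  qed
  then show ?thesis by (simp add: emeasure_eq_measure zero_less_measure_iff)
qed

text \<open>Carries the limit over to negative arguments, since \<open>log_char\<close> is
  controlled for positive \<open>t\<close> only.\<close>

lemma char_std_maj_uminus:
  "(CLINT T|SYT_measure lam. iexp (- s * std_maj lam T)) = cnj (CLINT T|SYT_measure lam. iexp (s * std_maj lam T))"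
  by (simp add: complex_integral_SYT exp_cnj)

text \<open>The variance bound gives \<open>(n t)^2 \<le> 648 s^2 / a\<close>. Hence the condition
  with \<open>162 = 648 / 4\<close> ensures \<open>n t \<le> 2\<close>, and the error
  \<open>2 a (n t / 2) ^ 4\<close> is at most \<open>648^2 / 8 = 52488\<close> times
  \<open>s ^ 4 / a\<close>.\<close>

lemma log_char_std_maj:
  assumes lam: "is_partition lam" and a: "1 \<le> aft lam" "162 * s\<^sup>2 \<le> real (aft lam)" and s: "0 < s"
  defines "t \<equiv> s / sqrt (hook_variance lam)"
  shows "0 < hook_variance lam" "real (sum_list lam) * t \<le> 2"
    and "\<bar>log_char lam t + s\<^sup>2 / 2\<bar> \<le> 52488 * s ^ 4 / real (aft lam)"
proof -
  let ?n = "real (sum_list lam)" and ?a = "real (aft lam)" and ?V = "hook_variance lam"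
  have "0 < sum_list lam" using aft_le[of lam] a(1) by linarith
  then have n: "0 < ?n" by (simp only: of_nat_0_less_iff)
  have "0 < ?a * ?n\<^sup>2 / 648"
    using n a(1) by (intro divide_pos_pos mult_pos_pos zero_less_power) auto
  then show V: "0 < ?V" using hook_variance_lower[OF lam] by linarith
  have t: "0 < t" "t\<^sup>2 = s\<^sup>2 / ?V" using s V by (auto simp: t_def power_divide)
  have "?a * (?n\<^sup>2 * s\<^sup>2) / 648 \<le> ?V * s\<^sup>2"
    using mult_right_mono[OF hook_variance_lower[OF lam], of "s\<^sup>2"] by (simp add: mult_ac)
  then have nt: "(?n * t)\<^sup>2 \<le> 648 * s\<^sup>2 / ?a"
    using V a(1) by (simp add: power_mult_distrib t(2) field_simps)
  also have "\<dots> \<le> 2\<^sup>2" using a by (simp add: field_simps)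
  finally show nt2: "?n * t \<le> 2" by (rule power2_le_imp_le) simp
  have "\<bar>log_char lam t + ?V * t\<^sup>2 / 2\<bar> \<le> 2 * ?a * (?n * t / 2) ^ 4"
    by (rule log_char_bound[OF lam t(1) nt2])
  also have "(?n * t / 2) ^ 4 = ((?n * t)\<^sup>2)\<^sup>2 / 16"
    by (simp add: power_divide flip: power_mult)
  also have "2 * ?a * (((?n * t)\<^sup>2)\<^sup>2 / 16) \<le> 2 * ?a * ((648 * s\<^sup>2 / ?a)\<^sup>2 / 16)"
    using nt by (intro mult_left_mono divide_right_mono power_mono) auto
  also have "\<dots> = 52488 * s ^ 4 / ?a"
    using a(1) by (simp add: power2_eq_square eval_nat_numeral field_simps)
  finally show "\<bar>log_char lam t + s\<^sup>2 / 2\<bar> \<le> 52488 * s ^ 4 / ?a"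
    using t V by simp
qed

theorem theorem3p3:
  fixes lam :: "nat \<Rightarrow> nat list"
  assumes "\<And>N. is_partition (lam N)"
  shows "asymptotically_normal (\<lambda>N. measure_pmf (pmf_of_set (SYT (lam N))))
             (\<lambda>N T. real (maj (lam N) T))
         \<longleftrightarrow> filterlim (\<lambda>N. aft (lam N)) at_top sequentially"
proof
  assume normal: "asymptotically_normal (\<lambda>N. SYT_measure (lam N)) (\<lambda>N T. real (maj (lam N) T))"
  show "filterlim (\<lambda>N. aft (lam N)) at_top sequentially"
    unfolding filterlim_at_top
  proof
    fix A
    \<comment> \<open>Chosen below every value that is possible while
      \<open>aft (lam N) \<le> A\<close>; positive probability at or below \<open>x\<close>
      therefore forces a larger aft.\<close>
    define x where "x = - (13 * sqrt (real A)) - 1"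
    have "(\<lambda>N. measure (SYT_measure (lam N)) {T \<in> space (SYT_measure (lam N)). std_maj (lam N) T \<le> x})
        \<longlonglongrightarrow> measure std_normal_distribution {..x}"
      using normal by (simp add: asymptotically_normal_def)
    then have "\<forall>\<^sub>F N in sequentially. 0 < measure (SYT_measure (lam N)) {T \<in> space (SYT_measure (lam N)). std_maj (lam N) T \<le> x}"
      by (rule order_tendstoD(1)) (rule std_normal_atMost_pos)
    then show "\<forall>\<^sub>F N in sequentially. A \<le> aft (lam N)"
    proof eventually_elim
      case (elim N)
      then have "measure (SYT_measure (lam N)) {T \<in> space (SYT_measure (lam N)). std_maj (lam N) T \<le> x} \<noteq> 0"
        by (rule less_imp_neq[symmetric])
      then have "set_pmf (pmf_of_set (SYT (lam N))) \<inter> {T \<in> space (SYT_measure (lam N)). std_maj (lam N) T \<le> x} \<noteq> {}"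
        unfolding measure_pmf_zero_iff .
      then obtain T where "T \<in> SYT (lam N)" "std_maj (lam N) T \<le> x"
        by (auto simp: SYT_nonempty finite_SYT)
      then have "sqrt (real A) \<le> sqrt (real (aft (lam N)))"
        using std_maj_lower[OF assms, of T N] unfolding x_def by linarith
      then show ?case by simp
    qed
  qed
next
  assume aft: "filterlim (\<lambda>N. aft (lam N)) at_top sequentially"
  then have real_aft: "filterlim (\<lambda>N. real (aft (lam N))) at_top sequentially"
    by (rule filterlim_compose[OF filterlim_real_sequentially])
  \<comment> \<open>The tableaux live on varying spaces; Levy's theorem is applied to the laws on
    the real line.\<close>
  define D where "D N = distr (SYT_measure (lam N)) borel (std_maj (lam N))" for N
  have char_D: "char (D N) s = (CLINT T|SYT_measure (lam N). iexp (s * std_maj (lam N) T))" for N s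
    unfolding D_def char_def by (subst integral_distr) auto
  have pos: "(\<lambda>N. char (D N) s) \<longlonglongrightarrow> of_real (exp (- (s\<^sup>2 / 2)))" if s: "0 < s" for s
  proof -
    define t where "t N = s / sqrt (hook_variance (lam N))" for N
    have ev: "\<forall>\<^sub>F N in sequentially. 1 \<le> aft (lam N) \<and> 162 * s\<^sup>2 \<le> real (aft (lam N))"
      using aft real_aft by (auto simp: filterlim_at_top eventually_conj_iff)
    have "(\<lambda>N. log_char (lam N) (t N) + s\<^sup>2 / 2) \<longlonglongrightarrow> 0"
    proof (rule Lim_null_comparison)
      show "\<forall>\<^sub>F N in sequentially. norm (log_char (lam N) (t N) + s\<^sup>2 / 2) \<le> 52488 * s ^ 4 / real (aft (lam N))"
        using ev
      proof eventually_elim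
        case (elim N)
        then show ?case
          unfolding t_def real_norm_def using s by (intro log_char_std_maj(3)[OF assms]) auto
      qed
      show "(\<lambda>N. 52488 * s ^ 4 / real (aft (lam N))) \<longlonglongrightarrow> 0"
        by (rule real_tendsto_divide_at_top[OF tendsto_const real_aft])
    qed
    from tendsto_diff[OF this tendsto_const[of "s\<^sup>2 / 2"]]
    have "(\<lambda>N. log_char (lam N) (t N)) \<longlonglongrightarrow> - (s\<^sup>2 / 2)" by simp
    then have "(\<lambda>N. complex_of_real (exp (log_char (lam N) (t N)))) \<longlonglongrightarrow> of_real (exp (- (s\<^sup>2 / 2)))"
      by (intro tendsto_of_real tendsto_exp)
    moreover have "\<forall>\<^sub>F N in sequentially. complex_of_real (exp (log_char (lam N) (t N))) = char (D N) s"
      using ev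
    proof eventually_elim
      case (elim N)
      then show ?case
        unfolding char_D t_def using s log_char_std_maj(1,2)[OF assms, of N s]
        by (intro char_std_maj[OF assms, symmetric]) auto
    qed
    ultimately show ?thesis by (rule Lim_transform_eventually)
  qed
  have D: "real_distribution (D N)" for N
    unfolding D_def by (rule prob_space.real_distribution_distr[OF measure_pmf.prob_space_axioms]) simp
  have "weak_conv_m D std_normal_distribution"
  proof (rule levy_continuity)
    show "(\<lambda>N. char (D N) s) \<longlonglongrightarrow> char std_normal_distribution s" for s
    proof (cases s "0 :: real" rule: linorder_cases)
      case less
      then have "(\<lambda>N. cnj (char (D N) (- s))) \<longlonglongrightarrow> cnj (of_real (exp (- ((- s)\<^sup>2 / 2))))"
        by (intro tendsto_cnj pos) simp
      moreover have "cnj (char (D N) (- s)) = char (D N) s" for N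
        using char_std_maj_uminus[of "lam N" "- s"] by (simp add: char_D)
      ultimately show ?thesis by (simp add: char_std_normal_distribution)
    next
      case equal
      then show ?thesis
        using real_distribution.char_zero[OF D] by (simp add: char_std_normal_distribution)
    next
      case greater
      then show ?thesis using pos[of s] by (simp add: char_std_normal_distribution)
    qed
  qed (use D real_dist_normal_dist in auto)
  \<comment> \<open>The normal law has no atoms, so weak convergence gives convergence of the
    distribution functions at every point.\<close>
  moreover have "isCont (cdf std_normal_distribution) x" for x
  proof -
    interpret real_distribution std_normal_distribution by (rule real_dist_normal_dist)
    have "emeasure std_normal_distribution {x} = 0"
      by (subst emeasure_density) (auto intro!: nn_integral_null_set finite_imp_null_set_lborel)
    then show ?thesis by (simp add: isCont_cdf measure_def)
  qed
  ultimately have "(\<lambda>N. cdf (D N) x) \<longlonglongrightarrow> cdf std_normal_distribution x" for x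
    by (simp add: weak_conv_m_def weak_conv_def)
  moreover have "cdf (D N) x = measure (SYT_measure (lam N)) {T \<in> space (SYT_measure (lam N)). std_maj (lam N) T \<le> x}" for N x
    unfolding cdf_def D_def by (subst measure_distr) (auto intro!: arg_cong2[where f = measure])
  ultimately show "asymptotically_normal (\<lambda>N. SYT_measure (lam N)) (\<lambda>N T. real (maj (lam N) T))"
    by (simp add: asymptotically_normal_def cdf_def)
qed

end
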